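(* Let $\alpha_1>0$ and $\gamma>0$, let $e_z\in\mathbb{R}^3$ be a unit vector, and consider the time-invariant ODE $$\begin{cases}\dot z_{p_1}=-\alpha_1 z_{p_1},\\ \dot z_2=\gamma\,S^2(e_z-z_2)\,(z_2-z_{p_1}),\end{cases}\qquad (\mathrm{E}_1)$$ with state $\xi_1=(z_{p_1},z_2)\in\Upsilon_1=\mathbb{R}^3\times\mathbb{S}_{e_z}$. Then the following hold. (1) The state space of $(\mathrm{E}_1)$ is $\Upsilon_1$ (i.e. $(\mathrm{E}_1)$ defines a dynamical system on $\Upsilon_1$), it admits exactly two equilibrium points, namely the origin $(0,0)$ and $(0,2e_z)$, and every trajectory of $(\mathrm{E}_1)$ in $\Upsilon_1$ converges to one of these two equilibrium points. (a) The system $(\mathrm{E}_1)$ on $\Upsilon_1$ is almost globally asymptotically stable with respect to the origin $(0,0)$, and the origin is locally exponentially stable. (b) For every compact subset $K$ of $\Upsilon_1^*=\mathbb{R}^3\times(\mathbb{S}_{e_z}\setminus\{2e_z\})$ and every $\varrho>0$, there exist positive gains $(\alpha_1,\gamma)$ such that all trajectories of $(\mathrm{E}_1)$ (with these gains) starting in $K$ converge exponentially to the origin with an exponential rate larger than or equal to $\varrho$.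
   Context: For $v\in\mathbb{R}^3$, $S(v)$ denotes the $3\times 3$ skew-symmetric matrix with $S(v)w=v\times w$ for all $w\in\mathbb{R}^3$, and $S^2(v)=S(v)S(v)$. $\mathbb{S}^2=\{x\in\mathbb{R}^3:\|x\|=1\}$, and $\mathbb{S}_{e_z}=\{z\in\mathbb{R}^3: e_z-z\in\mathbb{S}^2\}$ (the unit sphere centered at $e_z$). A dynamical system $\dot x=f(x)$ on a differential manifold $X$ is called almost globally asymptotically stable with respect to an equilibrium point $x_0$ of $f$ if it is (Lyapunov) locally stable with respect to $x_0$ and there exists an open and dense subset $X_1$ of $X$ such that every trajectory starting in $X_1$ converges asymptotically to $x_0$. A trajectory $\xi(t)$ converges exponentially to the origin with exponential rate larger than or equal to $\varrho$ if there is a constant $C>0$ with $\|\xi(t)\|\le C e^{-\varrho t}$ for all $t\ge 0$. *)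

theory Defs
  imports "HOL-Analysis.Analysis"
begin

definition skew :: "real^3 \<Rightarrow> real^3^3" where
  "skew v = matrix (cross3 v)"

lemma skew_mult_vec: "skew v *v w = cross3 v w"
  by (simp add: skew_def matrix_def matrix_vector_mult_def vec_eq_iff cross3_def axis_def
      forall_3 sum_3 algebra_simps)

lemma transpose_skew: "transpose (skew v) = - skew v"
  by (simp add: skew_def matrix_def transpose_def vec_eq_iff cross3_def axis_def forall_3)

(* Solutions on a time set J; at the endpoints of an interval J the derivative is one-sided. *)
definition solution_on ::
  "('a::real_normed_vector \<Rightarrow> 'a) \<Rightarrow> real set \<Rightarrow> 'a set \<Rightarrow> (real \<Rightarrow> 'a) \<Rightarrow> bool" where
  "solution_on f J X \<xi> \<longleftrightarrow>
     (\<forall>t\<in>J. (\<xi> has_vector_derivative f (\<xi> t)) (at t within J) \<and> \<xi> t \<in> X)"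

definition trajectory ::
  "('a::real_normed_vector \<Rightarrow> 'a) \<Rightarrow> 'a set \<Rightarrow> (real \<Rightarrow> 'a) \<Rightarrow> bool" where
  "trajectory f X \<xi> \<longleftrightarrow> solution_on f {0..} X \<xi>"

(* X is a submanifold of the ambient space 'a, on which f is given.  The condition says that
   f restricts to a complete vector field on X: through each point of X there is a solution
   that is defined for all times and stays in X, and every solution in the ambient space through
   that point, on whatever interval, is a restriction of it. *)
definition dynamical_system_on ::
  "('a::real_normed_vector \<Rightarrow> 'a) \<Rightarrow> 'a set \<Rightarrow> bool" where
  "dynamical_system_on f X \<longleftrightarrow>
     (\<forall>x\<in>X. \<exists>\<phi>. solution_on f UNIV X \<phi> \<and> \<phi> 0 = x \<and>
        (\<forall>J \<psi>. is_interval J \<and> 0 \<in> J \<and> solution_on f J UNIV \<psi> \<and> \<psi> 0 = x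
           \<longrightarrow> (\<forall>t\<in>J. \<psi> t = \<phi> t)))"

definition equilibria :: "('a::real_normed_vector \<Rightarrow> 'a) \<Rightarrow> 'a set \<Rightarrow> 'a set" where
  "equilibria f X = {x \<in> X. f x = 0}"

definition locally_stable ::
  "('a::real_normed_vector \<Rightarrow> 'a) \<Rightarrow> 'a set \<Rightarrow> 'a \<Rightarrow> bool" where
  "locally_stable f X x\<^sub>0 \<longleftrightarrow>
     (\<forall>\<epsilon>>0. \<exists>\<delta>>0. \<forall>\<xi>. trajectory f X \<xi> \<and> dist (\<xi> 0) x\<^sub>0 < \<delta>
        \<longrightarrow> (\<forall>t\<ge>0. dist (\<xi> t) x\<^sub>0 < \<epsilon>))"

definition almost_globally_asymptotically_stable ::
  "('a::real_normed_vector \<Rightarrow> 'a) \<Rightarrow> 'a set \<Rightarrow> 'a \<Rightarrow> bool" where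
  "almost_globally_asymptotically_stable f X x\<^sub>0 \<longleftrightarrow>
     x\<^sub>0 \<in> equilibria f X \<and> locally_stable f X x\<^sub>0 \<and>
     (\<exists>X\<^sub>1. openin (top_of_set X) X\<^sub>1 \<and> X \<subseteq> closure X\<^sub>1 \<and>
        (\<forall>\<xi>. trajectory f X \<xi> \<and> \<xi> 0 \<in> X\<^sub>1 \<longrightarrow> (\<xi> \<longlongrightarrow> x\<^sub>0) at_top))"

definition locally_exponentially_stable ::
  "('a::real_normed_vector \<Rightarrow> 'a) \<Rightarrow> 'a set \<Rightarrow> 'a \<Rightarrow> bool" where
  "locally_exponentially_stable f X x\<^sub>0 \<longleftrightarrow>
     x\<^sub>0 \<in> equilibria f X \<and>
     (\<exists>\<delta>>0. \<exists>C>0. \<exists>\<mu>>0. \<forall>\<xi>. trajectory f X \<xi> \<and> dist (\<xi> 0) x\<^sub>0 < \<delta>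
        \<longrightarrow> (\<forall>t\<ge>0. dist (\<xi> t) x\<^sub>0 \<le> C * exp (- \<mu> * t) * dist (\<xi> 0) x\<^sub>0))"

definition converges_exponentially :: "(real \<Rightarrow> 'a::real_normed_vector) \<Rightarrow> real \<Rightarrow> bool" where
  "converges_exponentially \<xi> \<rho> \<longleftrightarrow> (\<exists>C>0. \<forall>t\<ge>0. norm (\<xi> t) \<le> C * exp (- \<rho> * t))"

definition sphere_at :: "real^3 \<Rightarrow> (real^3) set" where
  "sphere_at e\<^sub>z = {z. e\<^sub>z - z \<in> sphere 0 1}"

definition Upsilon1 :: "real^3 \<Rightarrow> ((real^3) \<times> (real^3)) set" where
  "Upsilon1 e\<^sub>z = UNIV \<times> sphere_at e\<^sub>z"

definition Upsilon1_star :: "real^3 \<Rightarrow> ((real^3) \<times> (real^3)) set" where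
  "Upsilon1_star e\<^sub>z = UNIV \<times> (sphere_at e\<^sub>z - {2 *\<^sub>R e\<^sub>z})"

definition E1 :: "real \<Rightarrow> real \<Rightarrow> real^3 \<Rightarrow> (real^3) \<times> (real^3) \<Rightarrow> (real^3) \<times> (real^3)" where
  "E1 \<alpha>\<^sub>1 \<gamma> e\<^sub>z = (\<lambda>(z\<^sub>p, z\<^sub>2).
     (- \<alpha>\<^sub>1 *\<^sub>R z\<^sub>p, \<gamma> *\<^sub>R ((skew (e\<^sub>z - z\<^sub>2) ** skew (e\<^sub>z - z\<^sub>2)) *v (z\<^sub>2 - z\<^sub>p))))"

end

theory Submission
  imports Defs
begin

text \<open>Put \<open>x = e - z\<^sub>2\<close>, a point of the unit sphere.  Since \<open>p(t) = exp (- \<alpha> t) p(0)\<close>, the second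
  equation is \<open>x' = \<gamma> (u - (x \<bullet> u) x)\<close> with \<open>u(t) = e - p(t)\<close>.  It is the projectivisation of a linear
  equation, which gives global solutions.  The quantity \<open>x \<bullet> e - (2 \<gamma> / \<alpha>) \<bar>p\<bar>\<close> never decreases.  If it
  ever exceeds \<open>- 1\<close>, then \<open>x \<bullet> e\<close> stays away from \<open>- 1\<close> and a quadratic Lyapunov function decays
  exponentially; otherwise \<open>x\<close> tends to \<open>- e\<close>.  The first alternative is an open condition on the
  initial state.  It is dense because, for \<open>x\<close> and \<open>y\<close> driven by the same \<open>p\<close>,
  \<open>(\<bar>x - y\<bar>\<^sup>2)' = - \<gamma> (x \<bullet> u + y \<bullet> u) \<bar>x - y\<bar>\<^sup>2\<close>, so that two solutions cannot both tend to \<open>- e\<close>.\<close>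

section \<open>Comparison estimates and linear equations\<close>

text \<open>At each time the field \<gamma> (u - (x \<bullet> u) x) is the gradient of \<gamma> (x
  \<bullet> u) on the sphere, and it is conformal: its flow consists of Moebius maps, that is, of
  Lorentz transformations acting on the directions of the light cone. Both the linear equation and
  the exact formula for the derivative of |x - y|^2 come from this. The obstacle is that p pushes x
  about while it decays, so the basin of the origin has no evident explicit description. But the
  height x \<bullet> e can be lost only through p, at a rate of at most \<gamma> |p|, hence by at
  most (\<gamma> / \<alpha>) |p(t)| in all the time after t. The monotone quantity is the height
  minus a reserve for this loss. If it never exceeds -1, the height is squeezed to -1 as the reserve
  dies out. Near -e the conformal factor is expanding. So for each initial p at most one initial x
  is exceptional, a fact that takes the place of a stable manifold theorem.\<close>

lemma has_real_derivative_inner: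
  assumes "(f has_vector_derivative f') (at t within S)"
    and "(g has_vector_derivative g') (at t within S)"
  shows "((\<lambda>t. f t \<bullet> g t) has_real_derivative (f t \<bullet> g' + f' \<bullet> g t)) (at t within S)"
  unfolding has_real_derivative_iff_has_vector_derivative
  by (rule bounded_bilinear.has_vector_derivative[OF bounded_bilinear_inner assms])

text \<open>The product \<open>q t * exp (- G t)\<close> has a nonnegative derivative. No sign of
  \<open>q\<close> is assumed, so upper bounds follow by applying the lemma to \<open>- q\<close>.
  The derivatives are taken within the interval because a trajectory is differentiable at time 0
  from the right only.\<close>

lemma integrating_factor:
  fixes q G :: "real \<Rightarrow> real"
  assumes "a \<le> b"
    and q: "\<And>t. t \<in> {a..b} \<Longrightarrow> (q has_real_derivative q' t) (at t within {a..b})"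
    and G: "\<And>t. t \<in> {a..b} \<Longrightarrow> (G has_real_derivative g t) (at t within {a..b})"
    and le: "\<And>t. t \<in> {a..b} \<Longrightarrow> g t * q t \<le> q' t"
  shows "q a * exp (G b - G a) \<le> q b"
proof -
  define w where "w t = q t * exp (- G t)" for t
  have w: "(w has_real_derivative (q' t - g t * q t) * exp (- G t)) (at t within {a..b})"
    if "t \<in> {a..b}" for t
    unfolding w_def by (rule derivative_eq_intros q[OF that] G[OF that] refl)+ (simp add: algebra_simps)
  have "w a \<le> w b"
  proof (rule DERIV_nonneg_imp_increasing_open[OF \<open>a \<le> b\<close>])
    show "\<exists>y. (w has_real_derivative y) (at t) \<and> 0 \<le> y" if "a < t" "t < b" for t
    proof -
      have t: "t \<in> {a..b}" "t \<in> interior {a..b}" using that by auto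
      show ?thesis
        using w[OF t(1)] le[OF t(1)] at_within_interior[OF t(2)] by (metis diff_ge_0_iff_ge exp_ge_zero mult_nonneg_nonneg)
    qed
    show "continuous_on {a..b} w"
      using w by (rule DERIV_continuous_on)
  qed
  then have "q a * exp (- G a) * exp (G b) \<le> q b * exp (- G b) * exp (G b)"
    unfolding w_def by (intro mult_right_mono) auto
  then show ?thesis
    by (simp add: mult.assoc flip: exp_add)
qed

text \<open>The bound on \<bar>q'\<bar> is two-sided so that the estimate can be run in either
  direction of time: \<open>b\<close> may lie to the left of \<open>a\<close>. This serves solutions
  at negative times, and it carries a zero of a function back to time 0.\<close>

lemma gronwall_closed_segment:
  fixes q :: "real \<Rightarrow> real"
  assumes q: "\<And>t. t \<in> closed_segment a b \<Longrightarrow> (q has_real_derivative q' t) (at t within closed_segment a b)"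
    and le: "\<And>t. t \<in> closed_segment a b \<Longrightarrow> \<bar>q' t\<bar> \<le> L * q t"
  shows "q b \<le> q a * exp (L * \<bar>b - a\<bar>)"
proof (cases "a \<le> b")
  case True
  then have S: "closed_segment a b = {a..b}" by (simp add: closed_segment_eq_real_ivl)
  have "- q a * exp (L * b - L * a) \<le> - q b"
  proof (rule integrating_factor[OF True, where q' = "\<lambda>t. - q' t" and g = "\<lambda>_. L"])
    fix t assume t: "t \<in> {a..b}"
    show "((\<lambda>t. - q t) has_real_derivative - q' t) (at t within {a..b})"
      using q t unfolding S by (auto intro: DERIV_minus)
    show "((\<lambda>t. L * t) has_real_derivative L) (at t within {a..b})"
      by (auto intro!: derivative_eq_intros)
    show "L * - q t \<le> - q' t"
      using le[of t] t unfolding S by auto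
  qed
  then show ?thesis using True by (simp add: right_diff_distrib)
next
  case False
  then have S: "closed_segment a b = {b..a}" by (simp add: closed_segment_eq_real_ivl)
  have "q b * exp (- L * a - - L * b) \<le> q a"
  proof (rule integrating_factor[where q' = q' and g = "\<lambda>_. - L"])
    show "b \<le> a" using False by simp
    fix t assume t: "t \<in> {b..a}"
    show "(q has_real_derivative q' t) (at t within {b..a})"
      using q t unfolding S by auto
    show "((\<lambda>t. - L * t) has_real_derivative - L) (at t within {b..a})"
      by (auto intro!: derivative_eq_intros)
    show "- L * q t \<le> q' t"
      using le[of t] t unfolding S by auto
  qed
  then have "q b * exp (L * (b - a)) * exp (L * (a - b)) \<le> q a * exp (L * (a - b))"
    by (intro mult_right_mono) (simp_all add: algebra_simps)
  then show ?thesis using False by (simp add: mult.assoc abs_if flip: exp_add distrib_left)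
qed

lemma norm_le_of_derivative_le_power:
  fixes f :: "real \<Rightarrow> 'a::real_normed_vector"
  assumes f: "\<And>s. \<bar>s\<bar> \<le> T \<Longrightarrow> (f has_vector_derivative f' s) (at s)"
    and "f 0 = 0" and t: "\<bar>t\<bar> \<le> T"
    and bound: "\<And>s. \<bar>s\<bar> \<le> T \<Longrightarrow> norm (f' s) \<le> C * (\<bar>s\<bar> ^ n / fact n)"
  shows "norm (f t) \<le> C * (\<bar>t\<bar> ^ Suc n / fact (Suc n))"
proof -
  define \<phi> where "\<phi> s = C * (s ^ Suc n / fact (Suc n))" for s :: real
  have \<phi>: "(\<phi> has_real_derivative C * (s ^ n / fact n)) (at s)" for s
  proof -
    have "(\<phi> has_real_derivative C * ((real (Suc n) * s ^ n) / fact (Suc n))) (at s)"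
      unfolding \<phi>_def using DERIV_pow[of "Suc n" s] by (intro DERIV_cmult DERIV_cdivide) simp
    then show ?thesis by (simp del: of_nat_Suc)
  qed
  have \<phi>_cont: "continuous_on S \<phi>" for S
    unfolding \<phi>_def by (intro continuous_intros) auto
  have f_cont: "continuous_on S f" if "\<And>s. s \<in> S \<Longrightarrow> \<bar>s\<bar> \<le> T" for S
    using f that by (meson continuous_at_imp_continuous_on has_vector_derivative_continuous)
  consider "t = 0" | "t > 0" | "t < 0" by linarith
  then show ?thesis
  proof cases
    case 1
    then show ?thesis using \<open>f 0 = 0\<close> by simp
  next
    case 2
    have "norm (f t - f 0) \<le> \<phi> t - \<phi> 0"
    proof (rule differentiable_bound_general[OF 2, where f' = f' and \<phi>' = "\<lambda>s. C * (s ^ n / fact n)"])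
      show "continuous_on {0..t} f" using t by (intro f_cont) auto
      show "continuous_on {0..t} \<phi>" by (rule \<phi>_cont)
      fix s assume s: "0 < s" "s < t"
      show "(f has_vector_derivative f' s) (at s)" using s t by (intro f) auto
      show "(\<phi> has_vector_derivative C * (s ^ n / fact n)) (at s)"
        using \<phi> by (simp only: has_real_derivative_iff_has_vector_derivative)
      show "norm (f' s) \<le> C * (s ^ n / fact n)" using bound[of s] s t by auto
    qed
    then show ?thesis using 2 \<open>f 0 = 0\<close> by (simp add: \<phi>_def)
  next
    case 3
    \<comment> \<open>To the left of 0 the comparison function is the odd reflection
      \<open>- \<phi> (- s)\<close>, whose derivative is C \<bar>s\<bar>^n / n! there.\<close>
    have "norm (f 0 - f t) \<le> - \<phi> (- 0) - - \<phi> (- t)"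
    proof (rule differentiable_bound_general[OF 3, where f' = f' and \<phi>' = "\<lambda>s. C * ((- s) ^ n / fact n)"])
      show "continuous_on {t..0} f" using t by (intro f_cont) auto
      show "continuous_on {t..0} (\<lambda>s. - \<phi> (- s))"
        by (intro continuous_intros continuous_on_compose2[OF \<phi>_cont]) auto
      fix s assume s: "t < s" "s < 0"
      show "(f has_vector_derivative f' s) (at s)" using s t by (intro f) auto
      have "((\<lambda>s. - \<phi> (- s)) has_real_derivative - (C * ((- s) ^ n / fact n) * - 1)) (at s)"
        by (intro DERIV_minus DERIV_chain2[OF \<phi>]) (auto intro!: derivative_eq_intros)
      then show "((\<lambda>s. - \<phi> (- s)) has_vector_derivative C * ((- s) ^ n / fact n)) (at s)"
        by (simp add: has_real_derivative_iff_has_vector_derivative)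
      show "norm (f' s) \<le> C * ((- s) ^ n / fact n)" using bound[of s] s t by auto
    qed
    then show ?thesis using 3 \<open>f 0 = 0\<close> by (simp add: \<phi>_def)
  qed
qed

text \<open>The terms of the Peano-Baker (Dyson) series of y' = A y: the increments of the Picard
  iteration rather than its iterates, so that the solution is a series. The interval integral is
  oriented, which covers negative times as well.\<close>

primrec picard_term ::
  "(real \<Rightarrow> 'a::euclidean_space \<Rightarrow>\<^sub>L 'a) \<Rightarrow> 'a \<Rightarrow> nat \<Rightarrow> real \<Rightarrow> 'a" where
  "picard_term A x 0 = (\<lambda>t. x)"
| "picard_term A x (Suc n) = (\<lambda>t. LBINT s=(0::real)..t. A s (picard_term A x n s))"

lemma picard_term_Suc_0: "picard_term A x (Suc n) 0 = 0"
  by simp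

lemma has_vector_derivative_LBINT:
  fixes f :: "real \<Rightarrow> 'a::euclidean_space"
  assumes "continuous_on UNIV f"
  shows "((\<lambda>t. LBINT s=(c::real)..t. f s) has_vector_derivative f t) (at t)"
proof -
  \<comment> \<open>The margin 1 puts \<open>t\<close> into the interior of a window that also
    contains \<open>c\<close>, so that the one-sided derivative from the fundamental theorem becomes
    a full one.\<close>
  define a b where "a = min c t - 1" and "b = max c t + 1"
  have "((\<lambda>t::real. LBINT s=c..t. f s) has_vector_derivative f t) (at t within {a..b})"
    using assms by (intro interval_integral_FTC2 continuous_on_subset[OF assms]) (auto simp: a_def b_def)
  moreover have "t \<in> interior {a..b}"
    by (auto simp: a_def b_def)
  ultimately show ?thesis
    using at_within_interior by metis
qed

lemma continuous_on_picard_term: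
  assumes "continuous_on UNIV A"
  shows "continuous_on UNIV (picard_term A x n)"
proof (induction n)
  case (Suc n)
  then have "continuous_on UNIV (\<lambda>s. A s (picard_term A x n s))"
    by (intro continuous_intros assms)
  then show ?case
    using has_vector_derivative_LBINT
    by (auto intro!: continuous_at_imp_continuous_on has_vector_derivative_continuous)
qed simp

lemma picard_term_Suc_derivative:
  assumes "continuous_on UNIV A"
  shows "(picard_term A x (Suc n) has_vector_derivative A t (picard_term A x n t)) (at t)"
  using has_vector_derivative_LBINT[of "\<lambda>s. A s (picard_term A x n s)"]
  by (simp add: blinfun.continuous_on continuous_on_picard_term assms)

lemma norm_picard_term_le:
  assumes A: "continuous_on UNIV A" and M: "\<And>s. \<bar>s\<bar> \<le> T \<Longrightarrow> norm (A s) \<le> M"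
    and t: "\<bar>t\<bar> \<le> T"
  shows "norm (picard_term A x n t) \<le> norm x * M ^ n * (\<bar>t\<bar> ^ n / fact n)"
  using t
proof (induction n arbitrary: t)
  case (Suc n)
  have "M \<ge> 0" using M[OF Suc.prems] norm_ge_zero order_trans by blast
  show ?case
  proof (rule norm_le_of_derivative_le_power[where T = T and f' = "\<lambda>t. A t (picard_term A x n t)"])
    show "norm (A s (picard_term A x n s)) \<le> norm x * M ^ Suc n * (\<bar>s\<bar> ^ n / fact n)"
      if "\<bar>s\<bar> \<le> T" for s
    proof -
      have "norm (A s (picard_term A x n s)) \<le> norm (A s) * norm (picard_term A x n s)"
        by (rule norm_blinfun)
      also have "\<dots> \<le> M * (norm x * M ^ n * (\<bar>s\<bar> ^ n / fact n))"
        using M[OF that] Suc.IH[OF that] \<open>M \<ge> 0\<close> by (intro mult_mono) auto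
      finally show ?thesis by (simp add: mult_ac)
    qed
  qed (use Suc.prems picard_term_Suc_derivative[OF A] picard_term_Suc_0 in auto)
qed simp

text \<open>On each window [-T, T] the coefficient is bounded by some M, and the n-th term of the
  series by |x| (M T)^n / n!. Hence the series and its termwise derivative converge uniformly there.
  As T is arbitrary, the solution is global although \<open>A\<close> need not be bounded on the
  whole line.\<close>

proposition linear_ode_solution_exists:
  fixes A :: "real \<Rightarrow> 'a::euclidean_space \<Rightarrow>\<^sub>L 'a"
  assumes A: "continuous_on UNIV A"
  obtains y where "y 0 = x" "\<And>t. (y has_vector_derivative A t (y t)) (at t)"
proof -
  define Y where "Y = picard_term A x"
  define y where "y t = (\<Sum>n. Y n t)" for t
  have Y0: "Y 0 = (\<lambda>t. x)" by (simp add: Y_def)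
  have YS0: "Y (Suc n) 0 = 0" for n by (simp add: Y_def)
  have "y 0 = x"
  proof -
    have "(\<lambda>n. Y n 0) = (\<lambda>n. if n = 0 then x else 0)"
      using YS0 Y0 by (auto simp: fun_eq_iff gr0_conv_Suc)
    then show ?thesis using sums_single[of 0 "\<lambda>_. x"] by (simp add: y_def sums_iff)
  qed
  moreover have "(y has_vector_derivative A t (y t)) (at t)" for t
  proof -
    define T where "T = \<bar>t\<bar> + 1"
    have "T > 0" by (simp add: T_def)
    have "compact (A ` {-T..T})"
      by (rule compact_continuous_image[OF continuous_on_subset[OF A]]) auto
    then obtain M where "M > 0" and M: "\<And>s. s \<in> {-T..T} \<Longrightarrow> norm (A s) \<le> M"
      by (auto dest!: compact_imp_bounded simp: bounded_pos)
    have term_le: "norm (Y n s) \<le> norm x * ((M * T) ^ n / fact n)" if "s \<in> {-T..T}" for n s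
    proof -
      have "norm (Y n s) \<le> norm x * M ^ n * (\<bar>s\<bar> ^ n / fact n)"
        unfolding Y_def using that by (intro norm_picard_term_le[OF A, of T] M) auto
      also have "\<dots> \<le> norm x * M ^ n * (T ^ n / fact n)"
        using that \<open>M > 0\<close> by (intro mult_left_mono divide_right_mono power_mono) auto
      finally show ?thesis by (simp add: power_mult_distrib)
    qed
    have summable: "summable (\<lambda>n. norm x * ((M * T) ^ n / fact n))"
      using summable_exp[of "M * T"] by (intro summable_mult) (simp add: field_simps)
    have lim: "uniform_limit {-T..T} (\<lambda>n s. \<Sum>i<n. Y i s) y sequentially"
      unfolding y_def by (rule Weierstrass_m_test[OF term_le summable])
    \<comment> \<open>The derivative of term m + 1 is A applied to term m, and term 0 is constant.
      So differentiating the first n + 1 terms gives A applied to the first n; this shift by one is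
      undone at the end of the uniform estimate.\<close>
    define Y' where "Y' n s h = (case n of 0 \<Rightarrow> 0 | Suc m \<Rightarrow> h *\<^sub>R A s (Y m s))" for n s h
    have sum_Y': "(\<Sum>i<Suc n. Y' i s h) = h *\<^sub>R A s (\<Sum>i<n. Y i s)" for n s h
      by (simp add: Y'_def sum.lessThan_Suc_shift blinfun.sum_right scaleR_sum_right del: sum.lessThan_Suc)
    have "\<exists>g. \<forall>s\<in>{-T..T}. (\<lambda>n. Y n s) sums g s \<and>
        (g has_derivative (\<lambda>h. h *\<^sub>R A s (y s))) (at s within {-T..T})"
    proof (rule has_derivative_series[where f' = Y'])
      show "(Y n has_derivative Y' n s) (at s within {-T..T})" for n s
        using picard_term_Suc_derivative[OF A]
        by (cases n) (auto simp: Y0 Y_def Y'_def[abs_def] has_vector_derivative_def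
            simp del: picard_term.simps(2) intro: has_derivative_at_withinI)
      show "\<forall>\<^sub>F n in sequentially. \<forall>s\<in>{-T..T}. \<forall>h.
          norm ((\<Sum>i<n. Y' i s h) - h *\<^sub>R A s (y s)) \<le> e * norm h" if "e > 0" for e
      proof -
        have "\<forall>\<^sub>F n in sequentially. \<forall>s\<in>{-T..T}. dist (\<Sum>i<n. Y i s) (y s) < e / M"
          using lim \<open>e > 0\<close> \<open>M > 0\<close> by (intro uniform_limitD) auto
        then have "\<forall>\<^sub>F n in sequentially. \<forall>s\<in>{-T..T}. \<forall>h.
            norm ((\<Sum>i<Suc n. Y' i s h) - h *\<^sub>R A s (y s)) \<le> e * norm h"
        proof (rule eventually_mono, safe)
          fix n s h
          assume *: "\<forall>s\<in>{-T..T}. dist (\<Sum>i<n. Y i s) (y s) < e / M" and s: "s \<in> {-T..T}"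
          have "norm (A s ((\<Sum>i<n. Y i s) - y s)) \<le> norm (A s) * norm ((\<Sum>i<n. Y i s) - y s)"
            by (rule norm_blinfun)
          also have "\<dots> \<le> M * (e / M)"
            using M[OF s] * s \<open>M > 0\<close> by (intro mult_mono) (auto simp: dist_norm less_imp_le)
          finally have "\<bar>h\<bar> * norm (A s ((\<Sum>i<n. Y i s) - y s)) \<le> \<bar>h\<bar> * e"
            using \<open>M > 0\<close> by (intro mult_left_mono) auto
          moreover have "(\<Sum>i<Suc n. Y' i s h) - h *\<^sub>R A s (y s) = h *\<^sub>R A s ((\<Sum>i<n. Y i s) - y s)"
            unfolding sum_Y' by (simp add: blinfun.diff_right scaleR_diff_right)
          ultimately show "norm ((\<Sum>i<Suc n. Y' i s h) - h *\<^sub>R A s (y s)) \<le> e * norm h"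
            by (simp add: mult.commute del: sum.lessThan_Suc)
        qed
        then show ?thesis
          by (subst (asm) eventually_sequentially_Suc)
      qed
      show "0 \<in> {-T..T}" using \<open>T > 0\<close> by simp
      then have "summable (\<lambda>n. Y n 0)"
        by (intro summable_comparison_test'[OF summable] term_le)
      then show "(\<lambda>n. Y n 0) sums y 0"
        unfolding y_def by (rule summable_sums)
    qed simp
    then obtain g where g: "\<And>s. s \<in> {-T..T} \<Longrightarrow> (\<lambda>n. Y n s) sums g s"
      and g': "\<And>s. s \<in> {-T..T} \<Longrightarrow>
        (g has_vector_derivative A s (y s)) (at s within {-T..T})"
      unfolding has_vector_derivative_def by metis
    have eq: "g s = y s" if "s \<in> {-T..T}" for s
      unfolding y_def using sums_unique[OF g[OF that]] .
    have t: "t \<in> {-T..T}" "t \<in> interior {-T..T}"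
      by (auto simp: T_def)
    have "(y has_vector_derivative A t (y t)) (at t within {-T..T})"
      using has_vector_derivative_weaken[OF g'[OF t(1)] t(1) order_refl eq] by simp
    then show ?thesis
      using at_within_interior[OF t(2)] by metis
  qed
  ultimately show thesis using that by blast
qed

section \<open>Reduction to the sphere and global solutions\<close>

text \<open>With x = e - z and u = e - p one has z - p = u - x. The x part is killed by the cross
  product with x, and Lagrange's identity rewrites the rest. The factor x \<bullet> x is kept since
  the formula is also used before a solution is known to stay on the sphere.\<close>

lemma E1_eq:
  "E1 a g e (p, z) = (- a *\<^sub>R p,
     g *\<^sub>R (((e - z) \<bullet> (e - p)) *\<^sub>R (e - z) - ((e - z) \<bullet> (e - z)) *\<^sub>R (e - p)))"
proof -
  have "cross3 x (cross3 x (u - x)) = (x \<bullet> u) *\<^sub>R x - (x \<bullet> x) *\<^sub>R u" for x u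
    by (simp add: Lagrange inner_diff_right scaleR_diff_left scaleR_diff_right)
  from this[of "e - z" "e - p"] show ?thesis
    by (simp add: E1_def skew_mult_vec flip: matrix_vector_mul_assoc)
qed

lemma mem_Upsilon1_iff: "\<xi> \<in> Upsilon1 e \<longleftrightarrow> norm (e - snd \<xi>) = 1"
  by (cases \<xi>) (simp add: Upsilon1_def sphere_at_def)

locale tilt_observer =
  fixes \<alpha> \<gamma> :: real and e :: "real^3"
  assumes \<alpha>_pos: "\<alpha> > 0" and \<gamma>_pos: "\<gamma> > 0" and norm_e: "norm e = 1"
begin

definition drive :: "real^3 \<Rightarrow> real \<Rightarrow> real^3" where
  "drive p t = e - exp (- \<alpha> * t) *\<^sub>R p"

definition sphere_solution :: "real^3 \<Rightarrow> real set \<Rightarrow> (real \<Rightarrow> real^3) \<Rightarrow> bool" where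
  "sphere_solution p J x \<longleftrightarrow> (\<forall>t\<in>J. norm (x t) = 1 \<and>
     (x has_vector_derivative \<gamma> *\<^sub>R (drive p t - (x t \<bullet> drive p t) *\<^sub>R x t)) (at t within J))"

lemma sphere_solution_norm: "sphere_solution p J x \<Longrightarrow> t \<in> J \<Longrightarrow> norm (x t) = 1"
  by (simp add: sphere_solution_def)

lemma sphere_solution_inner_self: "sphere_solution p J x \<Longrightarrow> t \<in> J \<Longrightarrow> x t \<bullet> x t = 1"
  by (simp add: sphere_solution_def norm_eq_1)

lemma sphere_solution_derivative:
  "sphere_solution p J x \<Longrightarrow> t \<in> J \<Longrightarrow>
    (x has_vector_derivative \<gamma> *\<^sub>R (drive p t - (x t \<bullet> drive p t) *\<^sub>R x t)) (at t within J)"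
  by (simp add: sphere_solution_def)

lemma sphere_solution_subset:
  "sphere_solution p J x \<Longrightarrow> S \<subseteq> J \<Longrightarrow> sphere_solution p S x"
  by (auto simp: sphere_solution_def intro!: has_vector_derivative_within_subset[of x _ _ J S])

lemma e_inner_e: "e \<bullet> e = 1"
  using norm_e by (simp add: norm_eq_1)

lemma exp_derivative:
  "((\<lambda>t. exp (- \<alpha> * t)) has_real_derivative - \<alpha> * exp (- \<alpha> * t)) (at t within S)"
  by (auto intro!: derivative_eq_intros)

lemma sphere_solution_imp_solution_on:
  assumes "sphere_solution p J x"
  shows "solution_on (E1 \<alpha> \<gamma> e) J (Upsilon1 e) (\<lambda>t. (exp (- \<alpha> * t) *\<^sub>R p, e - x t))"
  unfolding solution_on_def
proof (intro ballI conjI)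
  fix t assume t: "t \<in> J"
  have "((\<lambda>t. exp (- \<alpha> * t) *\<^sub>R p) has_vector_derivative (- \<alpha>) *\<^sub>R exp (- \<alpha> * t) *\<^sub>R p) (at t within J)"
    using has_vector_derivative_scaleR[OF exp_derivative has_vector_derivative_const] by fastforce
  moreover have "((\<lambda>t. e - x t) has_vector_derivative 0 - \<gamma> *\<^sub>R (drive p t - (x t \<bullet> drive p t) *\<^sub>R x t))
      (at t within J)"
    by (intro has_vector_derivative_diff has_vector_derivative_const sphere_solution_derivative[OF assms t])
  ultimately have "((\<lambda>t. (exp (- \<alpha> * t) *\<^sub>R p, e - x t)) has_vector_derivative
      ((- \<alpha>) *\<^sub>R exp (- \<alpha> * t) *\<^sub>R p, 0 - \<gamma> *\<^sub>R (drive p t - (x t \<bullet> drive p t) *\<^sub>R x t))) (at t within J)"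
    by (rule has_vector_derivative_Pair)
  moreover have "((- \<alpha>) *\<^sub>R exp (- \<alpha> * t) *\<^sub>R p, 0 - \<gamma> *\<^sub>R (drive p t - (x t \<bullet> drive p t) *\<^sub>R x t))
      = E1 \<alpha> \<gamma> e (exp (- \<alpha> * t) *\<^sub>R p, e - x t)"
    unfolding E1_eq by (simp add: sphere_solution_inner_self[OF assms t] drive_def scaleR_diff_right)
  ultimately show "((\<lambda>t. (exp (- \<alpha> * t) *\<^sub>R p, e - x t)) has_vector_derivative
      E1 \<alpha> \<gamma> e (exp (- \<alpha> * t) *\<^sub>R p, e - x t)) (at t within J)"
    by simp
  show "(exp (- \<alpha> * t) *\<^sub>R p, e - x t) \<in> Upsilon1 e"
    using sphere_solution_norm[OF assms t] by (simp add: mem_Upsilon1_iff)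
qed

text \<open>The solution is only assumed to live in the ambient space, so the invariance of the
  sphere has to be proved. The velocity of x is orthogonal to x even off the sphere, hence x
  \<bullet> x is constant on the interval. Likewise exp (\<alpha> t) p(t) is constant, which
  decouples p.\<close>

lemma solution_on_imp_sphere_solution:
  assumes J: "is_interval J" "0 \<in> J" and \<psi>: "solution_on (E1 \<alpha> \<gamma> e) J UNIV \<psi>"
    and init: "\<psi> 0 \<in> Upsilon1 e"
  shows "sphere_solution (fst (\<psi> 0)) J (\<lambda>t. e - snd (\<psi> t))"
    and "t \<in> J \<Longrightarrow> fst (\<psi> t) = exp (- \<alpha> * t) *\<^sub>R fst (\<psi> 0)"
proof -
  define p x where "p t = fst (\<psi> t)" and "x t = e - snd (\<psi> t)" for t
  have convex: "convex J" using J(1) by (rule is_interval_convex)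
  have p': "(p has_vector_derivative - \<alpha> *\<^sub>R p t) (at t within J)"
    and x': "(x has_vector_derivative \<gamma> *\<^sub>R ((x t \<bullet> x t) *\<^sub>R (e - p t) - (x t \<bullet> (e - p t)) *\<^sub>R x t)) (at t within J)"
    if t: "t \<in> J" for t
  proof -
    have *: "(\<psi> has_vector_derivative E1 \<alpha> \<gamma> e (fst (\<psi> t), snd (\<psi> t))) (at t within J)"
      using \<psi> t by (simp add: solution_on_def)
    show "(p has_vector_derivative - \<alpha> *\<^sub>R p t) (at t within J)"
      using bounded_linear.has_vector_derivative[OF bounded_linear_fst *] unfolding E1_eq p_def[abs_def] by simp
    have "(x has_vector_derivative 0 - snd (E1 \<alpha> \<gamma> e (fst (\<psi> t), snd (\<psi> t)))) (at t within J)"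
      unfolding x_def[abs_def]
      by (intro has_vector_derivative_diff has_vector_derivative_const
          bounded_linear.has_vector_derivative[OF bounded_linear_snd *])
    then show "(x has_vector_derivative \<gamma> *\<^sub>R ((x t \<bullet> x t) *\<^sub>R (e - p t) - (x t \<bullet> (e - p t)) *\<^sub>R x t)) (at t within J)"
      unfolding E1_eq by (simp add: x_def p_def flip: scaleR_minus_right)
  qed
  have p_eq: "p t = exp (- \<alpha> * t) *\<^sub>R p 0" if t: "t \<in> J" for t
  proof -
    have "((\<lambda>t. exp (\<alpha> * t) *\<^sub>R p t) has_vector_derivative 0) (at s within J)" if s: "s \<in> J" for s
    proof -
      have "((\<lambda>t. exp (\<alpha> * t)) has_real_derivative \<alpha> * exp (\<alpha> * s)) (at s within J)"
        by (rule derivative_eq_intros refl)+ simp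
      from has_vector_derivative_scaleR[OF this p'[OF s]] show ?thesis by (simp add: mult.commute)
    qed
    from has_vector_derivative_zero_constant[OF convex this]
    obtain c where "\<And>s. s \<in> J \<Longrightarrow> exp (\<alpha> * s) *\<^sub>R p s = c" by blast
    from this[OF t] this[OF J(2)] have "exp (- \<alpha> * t) *\<^sub>R exp (\<alpha> * t) *\<^sub>R p t = exp (- \<alpha> * t) *\<^sub>R p 0"
      by simp
    then show ?thesis by (simp flip: exp_add)
  qed
  then show "t \<in> J \<Longrightarrow> fst (\<psi> t) = exp (- \<alpha> * t) *\<^sub>R fst (\<psi> 0)"
    by (simp add: p_def)
  have "((\<lambda>t. x t \<bullet> x t) has_vector_derivative 0) (at s within J)" if s: "s \<in> J" for s
    using has_real_derivative_inner[OF x'[OF s] x'[OF s]]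
    by (simp add: has_real_derivative_iff_has_vector_derivative inner_diff_left inner_diff_right inner_commute)
  from has_vector_derivative_zero_constant[OF convex this]
  obtain c where "\<And>s. s \<in> J \<Longrightarrow> x s \<bullet> x s = c" by blast
  then have xx: "x s \<bullet> x s = 1" if "s \<in> J" for s
    using that J(2) init by (auto simp: mem_Upsilon1_iff x_def norm_eq_1)
  show "sphere_solution (fst (\<psi> 0)) J (\<lambda>t. e - snd (\<psi> t))"
    unfolding x_def[symmetric] p_def[symmetric] sphere_solution_def drive_def
    using x' xx p_eq by (auto simp: norm_eq_1)
qed

section \<open>Solutions on the sphere: global existence, dependence on the data, uniqueness\<close>

lemma norm_drive_le: "norm (drive p t) \<le> 1 + exp (- \<alpha> * t) * norm p"
  unfolding drive_def using norm_triangle_ineq4[of e "exp (- \<alpha> * t) *\<^sub>R p"] by (simp add: norm_e)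

lemma norm_drive_le_abs:
  assumes "\<bar>t\<bar> \<le> T"
  shows "norm (drive p t) \<le> 1 + exp (\<alpha> * T) * norm p"
proof -
  have "\<alpha> * (- t) \<le> \<alpha> * T" using assms \<alpha>_pos by (intro mult_left_mono) auto
  then have "- \<alpha> * t \<le> \<alpha> * T" by simp
  then show ?thesis
    using norm_drive_le[of p t] by (smt (verit) exp_le_cancel_iff mult_right_mono norm_ge_zero)
qed

lemma continuous_on_drive: "continuous_on S (drive p)"
  unfolding drive_def[abs_def] by (intro continuous_intros)

text \<open>The equation on the sphere is the projectivisation of a linear equation that preserves the
  light cone: if \<open>Y' = \<gamma> \<eta> u\<close> and \<open>\<eta>' = \<gamma> (u \<bullet> Y)\<close> with \<open>\<bar>Y\<bar> = \<eta>\<close>, then \<open>x = Y / \<eta>\<close> solves it.\<close>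

lemma sphere_solution_exists:
  assumes "norm x\<^sub>0 = 1"
  obtains x where "sphere_solution p UNIV x" "x 0 = x\<^sub>0"
proof -
  define F where "F t = (\<lambda>(Y, \<eta>). (\<gamma> *\<^sub>R \<eta> *\<^sub>R drive p t, \<gamma> * (drive p t \<bullet> Y)))" for t
  define A where "A t = Blinfun (F t)" for t
  have "bounded_linear (F t)" for t
    unfolding linear_conv_bounded_linear[symmetric]
    by (rule linearI) (auto simp: F_def inner_add_right algebra_simps)
  then have A: "blinfun_apply (A t) = F t" for t
    by (simp add: A_def bounded_linear_Blinfun_apply)
  have "continuous_on UNIV A"
    by (rule continuous_on_blinfun_componentwise)
      (auto simp: A F_def case_prod_beta intro!: continuous_intros continuous_on_drive)
  then obtain y where y0: "y 0 = (x\<^sub>0, 1)" and y': "\<And>t. (y has_vector_derivative F t (y t)) (at t)"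
    using linear_ode_solution_exists[of A "(x\<^sub>0, 1)"] A by metis
  define Y \<eta> where "Y t = fst (y t)" and "\<eta> t = snd (y t)" for t
  have Y': "(Y has_vector_derivative \<gamma> *\<^sub>R \<eta> t *\<^sub>R drive p t) (at t)" for t
    using bounded_linear.has_vector_derivative[OF bounded_linear_fst y'[of t]]
    by (simp add: Y_def[abs_def] \<eta>_def F_def case_prod_beta)
  have \<eta>': "(\<eta> has_real_derivative \<gamma> * (drive p t \<bullet> Y t)) (at t)" for t
    using bounded_linear.has_vector_derivative[OF bounded_linear_snd y'[of t]]
    by (simp add: Y_def \<eta>_def[abs_def] F_def case_prod_beta has_real_derivative_iff_has_vector_derivative)
  have "((\<lambda>t. Y t \<bullet> Y t - (\<eta> t)\<^sup>2) has_real_derivative 0) (at t)" for t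
    by (rule derivative_eq_intros has_real_derivative_inner[OF Y' Y'] \<eta>' refl)+
      (simp add: inner_commute)
  then have "((\<lambda>t. Y t \<bullet> Y t - (\<eta> t)\<^sup>2) has_vector_derivative 0) (at t within UNIV)" for t
    by (simp add: has_real_derivative_iff_has_vector_derivative)
  from has_vector_derivative_zero_constant[OF convex_UNIV this]
  obtain c where "\<And>t. Y t \<bullet> Y t - (\<eta> t)\<^sup>2 = c" by auto
  moreover have "Y 0 \<bullet> Y 0 - (\<eta> 0)\<^sup>2 = 0"
    using assms by (simp add: Y_def \<eta>_def y0 norm_eq_1)
  ultimately have cone: "Y t \<bullet> Y t = (\<eta> t)\<^sup>2" for t
    by (metis eq_iff_diff_eq_0)
  have norm_Y: "norm (Y t) = \<bar>\<eta> t\<bar>" for t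
    by (simp add: norm_eq_sqrt_inner cone)
  \<comment> \<open>On the cone \<bar>Y\<bar> = \<bar>\<eta>\<bar>, so \<eta> alone satisfies a
    linear differential inequality. A zero at time \<open>t\<close> would then propagate to time 0,
    where \<eta> is 1.\<close>
  have nz: "\<eta> t \<noteq> 0" for t
  proof
    assume "\<eta> t = 0"
    define M where "M = 1 + exp (\<alpha> * \<bar>t\<bar>) * norm p"
    have "(\<eta> 0)\<^sup>2 \<le> (\<eta> t)\<^sup>2 * exp (2 * \<gamma> * M * \<bar>0 - t\<bar>)"
    proof (rule gronwall_closed_segment[where q' = "\<lambda>s. 2 * \<eta> s * (\<gamma> * (drive p s \<bullet> Y s))"])
      fix s assume s: "s \<in> closed_segment t 0"
      show "((\<lambda>s. (\<eta> s)\<^sup>2) has_real_derivative 2 * \<eta> s * (\<gamma> * (drive p s \<bullet> Y s))) (at s within closed_segment t 0)"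
        by (rule has_field_derivative_at_within) (rule derivative_eq_intros \<eta>' refl | simp)+
      have "\<bar>s\<bar> \<le> \<bar>t\<bar>"
        using s by (auto simp: closed_segment_eq_real_ivl split: if_splits)
      then have "norm (drive p s) \<le> M"
        unfolding M_def by (rule norm_drive_le_abs)
      then have "\<bar>drive p s \<bullet> Y s\<bar> \<le> M * \<bar>\<eta> s\<bar>"
        using Cauchy_Schwarz_ineq2[of "drive p s" "Y s"] norm_Y[of s]
        by (smt (verit) mult_right_mono norm_ge_zero)
      then have le: "2 * \<gamma> * \<bar>\<eta> s\<bar> * \<bar>drive p s \<bullet> Y s\<bar> \<le> 2 * \<gamma> * \<bar>\<eta> s\<bar> * (M * \<bar>\<eta> s\<bar>)"
        using \<gamma>_pos by (intro mult_left_mono) auto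
      have "\<bar>2 * \<eta> s * (\<gamma> * (drive p s \<bullet> Y s))\<bar> = 2 * \<gamma> * \<bar>\<eta> s\<bar> * \<bar>drive p s \<bullet> Y s\<bar>"
        using \<gamma>_pos by (simp add: abs_mult)
      also note le
      also have "2 * \<gamma> * \<bar>\<eta> s\<bar> * (M * \<bar>\<eta> s\<bar>) = 2 * \<gamma> * M * \<bar>\<eta> s\<bar>\<^sup>2"
        unfolding power2_eq_square by (simp only: mult_ac)
      finally show "\<bar>2 * \<eta> s * (\<gamma> * (drive p s \<bullet> Y s))\<bar> \<le> 2 * \<gamma> * M * (\<eta> s)\<^sup>2"
        by simp
    qed
    then show False
      using \<open>\<eta> t = 0\<close> y0 by (simp add: \<eta>_def)
  qed
  define x where "x t = (1 / \<eta> t) *\<^sub>R Y t" for t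
  have "sphere_solution p UNIV x"
    unfolding sphere_solution_def
  proof (intro ballI conjI)
    fix t
    show "norm (x t) = 1"
      using nz[of t] by (simp add: x_def norm_Y)
    have "((\<lambda>t. 1 / \<eta> t) has_real_derivative - (\<gamma> * (drive p t \<bullet> Y t)) / (\<eta> t)\<^sup>2) (at t)"
      using nz[of t] by (auto intro!: derivative_eq_intros \<eta>' simp: power2_eq_square)
    from has_vector_derivative_scaleR[OF this Y'[of t]]
    have "(x has_vector_derivative (1 / \<eta> t) *\<^sub>R \<gamma> *\<^sub>R \<eta> t *\<^sub>R drive p t
        + (- (\<gamma> * (drive p t \<bullet> Y t)) / (\<eta> t)\<^sup>2) *\<^sub>R Y t) (at t)"
      by (simp add: x_def[abs_def])
    moreover have "(1 / \<eta> t) *\<^sub>R \<gamma> *\<^sub>R \<eta> t *\<^sub>R drive p t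
        + (- (\<gamma> * (drive p t \<bullet> Y t)) / (\<eta> t)\<^sup>2) *\<^sub>R Y t = \<gamma> *\<^sub>R (drive p t - (x t \<bullet> drive p t) *\<^sub>R x t)"
      using nz[of t] by (simp add: x_def scaleR_diff_right inner_commute power2_eq_square)
    ultimately show "(x has_vector_derivative \<gamma> *\<^sub>R (drive p t - (x t \<bullet> drive p t) *\<^sub>R x t)) (at t within UNIV)"
      by simp
  qed
  moreover have "x 0 = x\<^sub>0"
    by (simp add: x_def Y_def \<eta>_def y0)
  ultimately show thesis using that by blast
qed

text \<open>Gronwall for the squared distance of two states, with different initial p allowed. Only
  \<open>drive p\<close> needs a bound: the other drive is \<open>drive p t + \<delta> t\<close>,
  and \<delta> is part of the distance. In the exponent, 2 \<gamma> comes from the two products of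
  \<bar>d\<bar> and \<bar>\<delta>\<bar>, 4 \<gamma> M from the two terms quadratic in d, and 2
  \<alpha> from the decay of \<delta>, which counts as growth backwards in time.\<close>

lemma sphere_solution_dependence:
  assumes x: "sphere_solution p (closed_segment 0 T) x"
    and x': "sphere_solution p' (closed_segment 0 T) x'"
    and M: "\<And>t. t \<in> closed_segment 0 T \<Longrightarrow> norm (drive p t) \<le> M"
  shows "(norm (x T - x' T))\<^sup>2 + (norm (exp (- \<alpha> * T) *\<^sub>R (p - p')))\<^sup>2
    \<le> ((norm (x 0 - x' 0))\<^sup>2 + (norm (p - p'))\<^sup>2) * exp ((2 * \<gamma> + 4 * \<gamma> * M + 2 * \<alpha>) * \<bar>T\<bar>)"
proof -
  let ?S = "closed_segment 0 T"
  define d \<delta> where "d t = x t - x' t" and "\<delta> t = exp (- \<alpha> * t) *\<^sub>R (p - p')" for t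
  define Q where "Q t = d t \<bullet> d t + \<delta> t \<bullet> \<delta> t" for t
  define Q' where "Q' t = 2 * \<gamma> * (- (d t \<bullet> \<delta> t) - (x t \<bullet> drive p t) * (d t \<bullet> d t)
      - (d t \<bullet> drive p t) * (x' t \<bullet> d t) + (x' t \<bullet> \<delta> t) * (x' t \<bullet> d t)) - 2 * \<alpha> * (\<delta> t \<bullet> \<delta> t)" for t
  have "Q T \<le> Q 0 * exp ((2 * \<gamma> + 4 * \<gamma> * M + 2 * \<alpha>) * \<bar>T - 0\<bar>)"
  proof (rule gronwall_closed_segment[where q = Q and q' = Q'])
    fix t assume t: "t \<in> ?S"
    have drive': "drive p' t = drive p t + \<delta> t"
      by (simp add: drive_def \<delta>_def algebra_simps)
    have "(d has_vector_derivative \<gamma> *\<^sub>R (drive p t - (x t \<bullet> drive p t) *\<^sub>R x t)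
        - \<gamma> *\<^sub>R (drive p' t - (x' t \<bullet> drive p' t) *\<^sub>R x' t)) (at t within ?S)"
      unfolding d_def[abs_def]
      by (intro has_vector_derivative_diff sphere_solution_derivative[OF x t] sphere_solution_derivative[OF x' t])
    note dd = has_real_derivative_inner[OF this this]
    have "(\<delta> has_vector_derivative (- \<alpha>) *\<^sub>R \<delta> t) (at t within ?S)"
      unfolding \<delta>_def[abs_def]
      using has_vector_derivative_scaleR[OF exp_derivative has_vector_derivative_const] by fastforce
    note \<delta>\<delta> = has_real_derivative_inner[OF this this]
    \<comment> \<open>Eliminating x t in favour of x' t and d t cancels the terms of order zero in
      the difference, so that each remaining term is quadratic in (d, \<delta>).\<close>
    have *: "x t = x' t + d t" by (simp add: d_def)
    show "(Q has_real_derivative Q' t) (at t within ?S)"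
      unfolding Q_def[abs_def] using DERIV_add[OF dd \<delta>\<delta>]
      by (rule DERIV_cong)
        (simp add: Q'_def drive' * inner_simps inner_commute algebra_simps)
    have b1: "\<bar>d t \<bullet> \<delta> t\<bar> \<le> norm (d t) * norm (\<delta> t)"
      by (rule Cauchy_Schwarz_ineq2)
    have b2: "\<bar>x t \<bullet> drive p t\<bar> \<le> M"
      using Cauchy_Schwarz_ineq2[of "x t" "drive p t"] M[OF t] sphere_solution_norm[OF x t] by simp
    have b3: "\<bar>d t \<bullet> drive p t\<bar> \<le> norm (d t) * M"
      using Cauchy_Schwarz_ineq2[of "d t" "drive p t"] M[OF t] by (smt (verit) mult_left_mono norm_ge_zero)
    have b4: "\<bar>x' t \<bullet> d t\<bar> \<le> norm (d t)" "\<bar>x' t \<bullet> \<delta> t\<bar> \<le> norm (\<delta> t)"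
      using Cauchy_Schwarz_ineq2[of "x' t"] sphere_solution_norm[OF x' t] by (metis mult_1)+
    have "M \<ge> 0" using M[OF t] norm_ge_zero order_trans by blast
    have c2: "\<bar>(x t \<bullet> drive p t) * (d t \<bullet> d t)\<bar> \<le> M * (norm (d t))\<^sup>2"
      using b2 by (simp add: abs_mult power2_norm_eq_inner mult_right_mono)
    have c3: "\<bar>(d t \<bullet> drive p t) * (x' t \<bullet> d t)\<bar> \<le> (norm (d t) * M) * norm (d t)"
      unfolding abs_mult using b3 b4 \<open>M \<ge> 0\<close> by (intro mult_mono) auto
    have c4: "\<bar>(x' t \<bullet> \<delta> t) * (x' t \<bullet> d t)\<bar> \<le> norm (\<delta> t) * norm (d t)"
      unfolding abs_mult using b4 by (intro mult_mono) auto
    have amgm: "2 * (norm (d t) * norm (\<delta> t)) \<le> (norm (d t))\<^sup>2 + (norm (\<delta> t))\<^sup>2"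
      using sum_squares_bound[of "norm (d t)" "norm (\<delta> t)"] by (simp add: mult.assoc)
    define B where "B = - (d t \<bullet> \<delta> t) - (x t \<bullet> drive p t) * (d t \<bullet> d t)
      - (d t \<bullet> drive p t) * (x' t \<bullet> d t) + (x' t \<bullet> \<delta> t) * (x' t \<bullet> d t)"
    have "\<bar>B\<bar> \<le> (norm (d t))\<^sup>2 + (norm (\<delta> t))\<^sup>2 + 2 * M * (norm (d t))\<^sup>2"
      unfolding B_def using b1 c2 c3 c4 amgm
      by (simp add: power2_eq_square mult_ac)
    then have B: "2 * \<gamma> * \<bar>B\<bar> \<le> 2 * \<gamma> * ((norm (d t))\<^sup>2 + (norm (\<delta> t))\<^sup>2 + 2 * M * (norm (d t))\<^sup>2)"
      using \<gamma>_pos by (intro mult_left_mono) auto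
    have "\<bar>Q' t\<bar> \<le> 2 * \<gamma> * \<bar>B\<bar> + 2 * \<alpha> * (norm (\<delta> t))\<^sup>2"
    proof -
      have "\<bar>Q' t\<bar> \<le> \<bar>2 * \<gamma> * B\<bar> + \<bar>2 * \<alpha> * (\<delta> t \<bullet> \<delta> t)\<bar>"
        unfolding Q'_def B_def[symmetric] by (rule abs_triangle_ineq4)
      then show ?thesis
        using \<gamma>_pos \<alpha>_pos by (simp add: abs_mult power2_norm_eq_inner)
    qed
    moreover have "0 \<le> 4 * \<gamma> * M * (norm (\<delta> t))\<^sup>2" "0 \<le> 2 * \<alpha> * (norm (d t))\<^sup>2"
      using \<gamma>_pos \<alpha>_pos \<open>M \<ge> 0\<close> by auto
    ultimately show "\<bar>Q' t\<bar> \<le> (2 * \<gamma> + 4 * \<gamma> * M + 2 * \<alpha>) * Q t"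
      using B unfolding Q_def power2_norm_eq_inner by (simp add: algebra_simps)
  qed
  then show ?thesis
    unfolding Q_def d_def \<delta>_def power2_norm_eq_inner by simp
qed

lemma sphere_solution_unique:
  assumes "sphere_solution p (closed_segment 0 t) x" "sphere_solution p (closed_segment 0 t) x'"
    and "x 0 = x' 0"
  shows "x t = x' t"
proof -
  have "norm (drive p s) \<le> 1 + exp (\<alpha> * \<bar>t\<bar>) * norm p" if "s \<in> closed_segment 0 t" for s
    using that by (intro norm_drive_le_abs) (auto simp: closed_segment_eq_real_ivl split: if_splits)
  from sphere_solution_dependence[OF assms(1,2) this] assms(3) show ?thesis by simp
qed

lemma dynamical_system_on_E1: "dynamical_system_on (E1 \<alpha> \<gamma> e) (Upsilon1 e)"
  unfolding dynamical_system_on_def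
proof
  fix \<xi>\<^sub>0 assume \<xi>\<^sub>0: "\<xi>\<^sub>0 \<in> Upsilon1 e"
  then have "norm (e - snd \<xi>\<^sub>0) = 1" by (simp add: mem_Upsilon1_iff)
  then obtain x where x: "sphere_solution (fst \<xi>\<^sub>0) UNIV x" and x0: "x 0 = e - snd \<xi>\<^sub>0"
    by (rule sphere_solution_exists)
  define \<phi> where "\<phi> t = (exp (- \<alpha> * t) *\<^sub>R fst \<xi>\<^sub>0, e - x t)" for t
  have "solution_on (E1 \<alpha> \<gamma> e) UNIV (Upsilon1 e) \<phi>"
    unfolding \<phi>_def[abs_def] by (rule sphere_solution_imp_solution_on[OF x])
  moreover have "\<phi> 0 = \<xi>\<^sub>0"
    by (simp add: \<phi>_def x0)
  moreover have "\<psi> t = \<phi> t"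
    if J: "is_interval J" "0 \<in> J" and \<psi>: "solution_on (E1 \<alpha> \<gamma> e) J UNIV \<psi>" "\<psi> 0 = \<xi>\<^sub>0" and t: "t \<in> J"
    for J \<psi> t
  proof -
    have init: "\<psi> 0 \<in> Upsilon1 e" using \<psi>(2) \<xi>\<^sub>0 by simp
    note * = solution_on_imp_sphere_solution[OF J \<psi>(1) init, unfolded \<psi>(2)]
    have seg: "closed_segment 0 t \<subseteq> J"
      using J t by (simp add: closed_segment_subset is_interval_convex)
    have "e - snd (\<psi> t) = x t"
      using sphere_solution_unique[OF sphere_solution_subset[OF *(1) seg] sphere_solution_subset[OF x]]
      by (simp add: x0 \<psi>(2))
    then have "snd (\<psi> t) = e - x t" by (simp add: algebra_simps)
    then show ?thesis
      using *(2)[OF t] by (simp add: \<phi>_def prod_eq_iff)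
  qed
  ultimately show "\<exists>\<phi>. solution_on (E1 \<alpha> \<gamma> e) UNIV (Upsilon1 e) \<phi> \<and> \<phi> 0 = \<xi>\<^sub>0 \<and>
      (\<forall>J \<psi>. is_interval J \<and> 0 \<in> J \<and> solution_on (E1 \<alpha> \<gamma> e) J UNIV \<psi> \<and> \<psi> 0 = \<xi>\<^sub>0
        \<longrightarrow> (\<forall>t\<in>J. \<psi> t = \<phi> t))"
    by (intro exI[of _ \<phi>] conjI allI impI ballI) auto
qed

section \<open>Lyapunov function and convergence\<close>

lemma exp_neg_tendsto_0: "c > 0 \<Longrightarrow> ((\<lambda>t::real. exp (- c * t)) \<longlongrightarrow> 0) at_top"
  by (rule filterlim_compose[OF exp_at_bot])
    (rule filterlim_tendsto_neg_mult_at_bot[OF tendsto_const _ filterlim_ident], simp)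

text \<open>The reserve 2 \<gamma> / \<alpha> |p| is twice the integral of \<gamma> |p| over all
  future times. It shrinks at the rate 2 \<gamma> |p|, while p lowers the height at a rate of at
  most \<gamma> |p|. The value is thus a level below which the height never falls again.\<close>

definition height_bound :: "(real^3) \<times> (real^3) \<Rightarrow> real" where
  "height_bound \<xi> = (e - snd \<xi>) \<bullet> e - 2 * \<gamma> / \<alpha> * norm (fst \<xi>)"

lemma norm_diff_e: "norm x = 1 \<Longrightarrow> (norm (e - x))\<^sup>2 = 2 - 2 * (x \<bullet> e)"
  unfolding power2_norm_eq_inner by (simp add: inner_diff_left inner_diff_right inner_commute e_inner_e norm_eq_1)

lemma inner_e_le_1: "norm x = 1 \<Longrightarrow> x \<bullet> e \<le> 1"
  using norm_cauchy_schwarz[of x e] by (simp add: norm_e)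

lemma inner_e_ge_minus_1: "norm x = 1 \<Longrightarrow> - 1 \<le> x \<bullet> e"
  using inner_e_le_1[of "- x"] by simp

lemma norm_e_minus_projection: "norm x = 1 \<Longrightarrow> (norm (e - (x \<bullet> e) *\<^sub>R x))\<^sup>2 = 1 - (x \<bullet> e)\<^sup>2"
  unfolding power2_norm_eq_inner
  by (simp add: inner_diff_left inner_diff_right inner_commute e_inner_e norm_eq_1 power2_eq_square)

lemma height_has_derivative:
  assumes "sphere_solution p J x" "t \<in> J"
  shows "((\<lambda>t. x t \<bullet> e) has_real_derivative
    \<gamma> * (1 - (x t \<bullet> e)\<^sup>2) - \<gamma> * exp (- \<alpha> * t) * (p \<bullet> (e - (x t \<bullet> e) *\<^sub>R x t))) (at t within J)"
  using has_real_derivative_inner[OF sphere_solution_derivative[OF assms] has_vector_derivative_const[of e]]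
  by (rule DERIV_cong)
    (simp add: drive_def inner_diff_left inner_diff_right e_inner_e power2_eq_square inner_commute algebra_simps)

text \<open>The square root, which vanishes at both poles, is what makes the coupling quadratic in
  the distances near the origin; the crude bound |p| would not give exponential decay.\<close>

lemma perturbation_le:
  assumes "norm x = 1"
  shows "\<bar>p \<bullet> (e - (x \<bullet> e) *\<^sub>R x)\<bar> \<le> norm p * sqrt (1 - (x \<bullet> e)\<^sup>2)"
  using Cauchy_Schwarz_ineq2[of p "e - (x \<bullet> e) *\<^sub>R x"]
  by (simp flip: norm_e_minus_projection[OF assms])

lemma height_bound_mono:
  assumes x: "sphere_solution p {0..} x" and "0 \<le> a" "a \<le> b"
  shows "x a \<bullet> e - 2 * \<gamma> / \<alpha> * (exp (- \<alpha> * a) * norm p) \<le> x b \<bullet> e - 2 * \<gamma> / \<alpha> * (exp (- \<alpha> * b) * norm p)"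
proof -
  define q q' where "q t = x t \<bullet> e - 2 * \<gamma> / \<alpha> * (exp (- \<alpha> * t) * norm p)"
    and "q' t = \<gamma> * (1 - (x t \<bullet> e)\<^sup>2) - \<gamma> * exp (- \<alpha> * t) * (p \<bullet> (e - (x t \<bullet> e) *\<^sub>R x t))
      - 2 * \<gamma> / \<alpha> * (- \<alpha> * exp (- \<alpha> * t) * norm p)" for t
  have "q a * exp (0 - 0) \<le> q b"
  proof (rule integrating_factor[OF \<open>a \<le> b\<close>, where q' = q' and g = "\<lambda>_. 0" and G = "\<lambda>_. 0"])
    fix t assume t: "t \<in> {a..b}"
    have sub: "sphere_solution p {a..b} x"
      using assms by (auto intro: sphere_solution_subset)
    show "(q has_real_derivative q' t) (at t within {a..b})"
      unfolding q_def[abs_def] q'_def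
      by (intro DERIV_diff DERIV_cmult DERIV_cmult_right height_has_derivative[OF sub t] exp_derivative)
    have nx: "norm (x t) = 1" using sphere_solution_norm[OF sub t] .
    have "sqrt (1 - (x t \<bullet> e)\<^sup>2) \<le> 1" by simp
    then have "norm p * sqrt (1 - (x t \<bullet> e)\<^sup>2) \<le> norm p * 1"
      by (intro mult_left_mono) auto
    then have "\<bar>p \<bullet> (e - (x t \<bullet> e) *\<^sub>R x t)\<bar> \<le> norm p"
      using perturbation_le[OF nx, of p] by simp
    then have "\<gamma> * exp (- \<alpha> * t) * (p \<bullet> (e - (x t \<bullet> e) *\<^sub>R x t)) \<le> \<gamma> * exp (- \<alpha> * t) * norm p"
      using \<gamma>_pos by (intro mult_left_mono) auto
    moreover have "0 \<le> \<gamma> * exp (- \<alpha> * t) * norm p"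
      using \<gamma>_pos by simp
    moreover have "(x t \<bullet> e)\<^sup>2 \<le> 1"
      using inner_e_le_1[OF nx] inner_e_ge_minus_1[OF nx] by (simp add: abs_square_le_1 abs_le_iff)
    then have "0 \<le> \<gamma> * (1 - (x t \<bullet> e)\<^sup>2)"
      using \<gamma>_pos by simp
    ultimately show "0 * q t \<le> q' t"
      using \<alpha>_pos by (simp add: q'_def)
  qed auto
  then show ?thesis by (simp add: q_def)
qed

text \<open>Decay of the Lyapunov function \<open>\<bar>e - x\<bar>\<^sup>2 + k \<bar>p\<bar>\<^sup>2\<close>; the weight \<open>k\<close> is such that the
  damping of \<open>p\<close> absorbs the coupling term split off by Young's inequality.\<close>

lemma lyapunov_decay:
  assumes x: "sphere_solution p {0..} x" and "0 \<le> a" "a \<le> b" and "c > 0"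
    and c: "\<And>t. t \<ge> a \<Longrightarrow> c - 1 \<le> x t \<bullet> e"
    and m: "m \<le> \<gamma> * c / 2" "m \<le> \<alpha>"
    and k: "k = 2 * \<gamma> / (c * \<alpha>)"
  shows "(norm (e - x b))\<^sup>2 + k * (exp (- \<alpha> * b) * norm p)\<^sup>2
    \<le> ((norm (e - x a))\<^sup>2 + k * (exp (- \<alpha> * a) * norm p)\<^sup>2) * exp (- m * (b - a))"
proof -
  define W where "W t = 2 - 2 * (x t \<bullet> e) + k * (exp (- \<alpha> * t) * norm p)\<^sup>2" for t
  define W' where "W' t = - 2 * (\<gamma> * (1 - (x t \<bullet> e)\<^sup>2)
      - \<gamma> * exp (- \<alpha> * t) * (p \<bullet> (e - (x t \<bullet> e) *\<^sub>R x t))) - 2 * \<alpha> * k * (exp (- \<alpha> * t) * norm p)\<^sup>2" for t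
  have sub: "sphere_solution p {a..b} x"
    using assms by (auto intro: sphere_solution_subset)
  have k\<alpha>: "k * \<alpha> = 2 * \<gamma> / c" "k > 0"
    using \<alpha>_pos \<gamma>_pos \<open>c > 0\<close> by (auto simp: k)
  have "- W a * exp (- m * b - - m * a) \<le> - W b"
  proof (rule integrating_factor[OF \<open>a \<le> b\<close>, where q' = "\<lambda>t. - W' t" and g = "\<lambda>_. - m"])
    fix t assume t: "t \<in> {a..b}"
    have "(W has_real_derivative 0 - 2 * (\<gamma> * (1 - (x t \<bullet> e)\<^sup>2)
        - \<gamma> * exp (- \<alpha> * t) * (p \<bullet> (e - (x t \<bullet> e) *\<^sub>R x t)))
        + k * (2 * (exp (- \<alpha> * t) * norm p) ^ 1 * (- \<alpha> * exp (- \<alpha> * t) * norm p))) (at t within {a..b})"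
      unfolding W_def[abs_def]
      by (intro DERIV_diff DERIV_add DERIV_cmult DERIV_const height_has_derivative[OF sub t])
        (auto intro!: derivative_eq_intros)
    then have "(W has_real_derivative W' t) (at t within {a..b})"
      by (rule DERIV_cong) (simp add: W'_def power2_eq_square algebra_simps)
    then show "((\<lambda>t. - W t) has_real_derivative - W' t) (at t within {a..b})"
      by (rule DERIV_minus)
    show "((\<lambda>t. - m * t) has_real_derivative - m) (at t within {a..b})"
      by (auto intro!: derivative_eq_intros)
    have nx: "norm (x t) = 1" using sphere_solution_norm[OF sub t] .
    define s P r where "s = x t \<bullet> e" and "P = exp (- \<alpha> * t) * norm p" and "r = sqrt (1 - s\<^sup>2)"
    have s: "s \<le> 1" "c - 1 \<le> s"
      using inner_e_le_1[OF nx] c[of t] t by (auto simp: s_def)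
    \<comment> \<open>Both follow from 1 - s^2 = (1 + s) (1 - s) with c \<le> 1 + s \<le> 2.\<close>
    have s2: "c * (1 - s) \<le> 1 - s\<^sup>2" "1 - s\<^sup>2 \<le> 2 * (1 - s)"
      using mult_right_mono[of c "1 + s" "1 - s"] mult_right_mono[of "1 + s" 2 "1 - s"] s
      by (simp_all add: power2_eq_square algebra_simps)
    then have r2: "r\<^sup>2 = 1 - s\<^sup>2"
      unfolding r_def using s \<open>c > 0\<close> by (smt (verit) mult_nonneg_nonneg real_sqrt_pow2)
    have "exp (- \<alpha> * t) * (p \<bullet> (e - s *\<^sub>R x t)) \<le> P * r"
      using mult_left_mono[OF order_trans[OF abs_ge_self perturbation_le[OF nx, of p]], of "exp (- \<alpha> * t)"]
      by (simp add: s_def P_def r_def mult.assoc)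
    \<comment> \<open>Young's inequality, weighted to split the damping in halves. After
      multiplication by \<gamma>, the r part costs at most \<gamma> c (1 - s) \<le> \<gamma> (1 -
      s^2), half of the damping of 2 - 2 s, and the P part is exactly half of the damping of k P^2.
      The other halves leave the rates \<gamma> c / 2 and \<alpha>.\<close>
    also have "2 * (P * r) \<le> c / 2 * r\<^sup>2 + 2 / c * P\<^sup>2"
    proof -
      have "0 \<le> (c * r - 2 * P)\<^sup>2" by simp
      then have "4 * c * (P * r) \<le> c\<^sup>2 * r\<^sup>2 + 4 * P\<^sup>2"
        by (simp add: power2_diff power_mult_distrib mult_ac)
      then have "4 * c * (P * r) / (2 * c) \<le> (c\<^sup>2 * r\<^sup>2 + 4 * P\<^sup>2) / (2 * c)"
        using \<open>c > 0\<close> by (intro divide_right_mono) auto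
      then show ?thesis
        using \<open>c > 0\<close> by (simp add: field_simps power2_eq_square)
    qed
    then have "P * r \<le> (c / 2 * r\<^sup>2 + 2 / c * P\<^sup>2) / 2" by simp
    finally have "2 * (exp (- \<alpha> * t) * (p \<bullet> (e - s *\<^sub>R x t))) \<le> c / 2 * r\<^sup>2 + 2 / c * P\<^sup>2" by simp
    also have "\<dots> \<le> c * (1 - s) + 2 / c * P\<^sup>2"
    proof -
      have "c / 2 * r\<^sup>2 \<le> c / 2 * (2 * (1 - s))"
        using s2(2) \<open>c > 0\<close> unfolding r2 by (intro mult_left_mono) auto
      then show ?thesis by (simp add: algebra_simps)
    qed
    finally have "\<gamma> * (2 * (exp (- \<alpha> * t) * (p \<bullet> (e - s *\<^sub>R x t)))) \<le> \<gamma> * (c * (1 - s) + 2 / c * P\<^sup>2)"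
      using \<gamma>_pos by (intro mult_left_mono) auto
    moreover have "\<gamma> * (c * (1 - s)) \<le> \<gamma> * (1 - s\<^sup>2)"
      using s2(1) \<gamma>_pos by (intro mult_left_mono) auto
    moreover have "m * (2 - 2 * s) \<le> \<gamma> * c / 2 * (2 - 2 * s)"
      using m(1) s by (intro mult_right_mono) auto
    moreover have "m * (k * P\<^sup>2) \<le> \<alpha> * (k * P\<^sup>2)"
      using m(2) k\<alpha> by (intro mult_right_mono) auto
    moreover have "\<gamma> * (2 / c * P\<^sup>2) = \<alpha> * (k * P\<^sup>2)"
    proof -
      have "\<alpha> * (k * P\<^sup>2) = (k * \<alpha>) * P\<^sup>2" by simp
      then show ?thesis unfolding k\<alpha> by simp
    qed
    ultimately show "- m * - W t \<le> - W' t"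
      unfolding W_def W'_def s_def[symmetric] P_def[symmetric] by (simp add: algebra_simps)
  qed
  then have "W b \<le> W a * exp (- m * b - - m * a)" by simp
  moreover have "W a = (norm (e - x a))\<^sup>2 + k * (exp (- \<alpha> * a) * norm p)\<^sup>2"
    "W b = (norm (e - x b))\<^sup>2 + k * (exp (- \<alpha> * b) * norm p)\<^sup>2"
    using sphere_solution_norm[OF sub] \<open>a \<le> b\<close> by (auto simp: W_def norm_diff_e)
  ultimately show ?thesis
    by (simp add: right_diff_distrib)
qed

section \<open>Decay and convergence of trajectories of the full system\<close>

lemma trajectory_sphere_solution:
  assumes "trajectory (E1 \<alpha> \<gamma> e) (Upsilon1 e) \<xi>"
  shows "sphere_solution (fst (\<xi> 0)) {0..} (\<lambda>t. e - snd (\<xi> t))"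
    and "t \<ge> 0 \<Longrightarrow> fst (\<xi> t) = exp (- \<alpha> * t) *\<^sub>R fst (\<xi> 0)"
    and "t \<ge> 0 \<Longrightarrow> \<xi> t \<in> Upsilon1 e"
proof -
  have J: "is_interval {0::real..}" "0 \<in> {0::real..}" by (auto simp: is_interval_1)
  have sol: "solution_on (E1 \<alpha> \<gamma> e) {0..} UNIV \<xi>" and mem: "\<And>t. t \<ge> 0 \<Longrightarrow> \<xi> t \<in> Upsilon1 e"
    using assms by (auto simp: trajectory_def solution_on_def)
  show "t \<ge> 0 \<Longrightarrow> \<xi> t \<in> Upsilon1 e" by (rule mem)
  show "sphere_solution (fst (\<xi> 0)) {0..} (\<lambda>t. e - snd (\<xi> t))"
    by (rule solution_on_imp_sphere_solution(1)[OF J sol mem]) simp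
  show "fst (\<xi> t) = exp (- \<alpha> * t) *\<^sub>R fst (\<xi> 0)" if "t \<ge> 0"
    by (rule solution_on_imp_sphere_solution(2)[OF J sol mem]) (use that in auto)
qed

lemma trajectory_exists:
  assumes "\<xi>\<^sub>0 \<in> Upsilon1 e"
  obtains \<xi> where "trajectory (E1 \<alpha> \<gamma> e) (Upsilon1 e) \<xi>" "\<xi> 0 = \<xi>\<^sub>0"
proof -
  have "norm (e - snd \<xi>\<^sub>0) = 1" using assms by (simp add: mem_Upsilon1_iff)
  then obtain x where x: "sphere_solution (fst \<xi>\<^sub>0) UNIV x" and x0: "x 0 = e - snd \<xi>\<^sub>0"
    by (rule sphere_solution_exists)
  have "trajectory (E1 \<alpha> \<gamma> e) (Upsilon1 e) (\<lambda>t. (exp (- \<alpha> * t) *\<^sub>R fst \<xi>\<^sub>0, e - x t))"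
    unfolding trajectory_def by (intro sphere_solution_imp_solution_on sphere_solution_subset[OF x]) auto
  from that[OF this] x0 show thesis by simp
qed

text \<open>Passing from the weighted sum v + k P to v + P costs the factor 1 + 1 / k at time b and
  1 + k at time a; taking square roots halves the rate. The starting time is arbitrary because the
  height may rise above the critical level only after a while.\<close>

lemma trajectory_decay:
  assumes \<xi>: "trajectory (E1 \<alpha> \<gamma> e) (Upsilon1 e) \<xi>" and "0 \<le> a" "a \<le> b" and "c > 0"
    and c: "\<And>t. t \<ge> a \<Longrightarrow> c - 1 \<le> (e - snd (\<xi> t)) \<bullet> e"
    and m: "m \<le> \<gamma> * c / 2" "m \<le> \<alpha>"
    and k: "k = 2 * \<gamma> / (c * \<alpha>)"
  shows "norm (\<xi> b) \<le> sqrt ((1 + 1 / k) * (1 + k)) * exp (- (m / 2) * (b - a)) * norm (\<xi> a)"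
proof -
  have "k > 0" using \<alpha>_pos \<gamma>_pos \<open>c > 0\<close> by (simp add: k)
  define v P where "v t = (norm (snd (\<xi> t)))\<^sup>2" and "P t = (norm (fst (\<xi> t)))\<^sup>2" for t
  have norm_\<xi>: "(norm (\<xi> t))\<^sup>2 = P t + v t" for t
    by (simp add: v_def P_def norm_prod_def)
  have vP: "v t \<ge> 0" "P t \<ge> 0" for t by (simp_all add: v_def P_def)
  have "v b + k * P b \<le> (v a + k * P a) * exp (- m * (b - a))"
    using lyapunov_decay[OF trajectory_sphere_solution(1)[OF \<xi>] \<open>0 \<le> a\<close> \<open>a \<le> b\<close> \<open>c > 0\<close> c m k]
      trajectory_sphere_solution(2)[OF \<xi>, of a] trajectory_sphere_solution(2)[OF \<xi>, of b] \<open>0 \<le> a\<close> \<open>a \<le> b\<close>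
    by (simp add: v_def P_def)
  then have le: "(1 + 1 / k) * (v b + k * P b) \<le> (1 + 1 / k) * ((v a + k * P a) * exp (- m * (b - a)))"
    using \<open>k > 0\<close> by (intro mult_left_mono) auto
  have "(norm (\<xi> b))\<^sup>2 \<le> (1 + 1 / k) * (v b + k * P b)"
    unfolding norm_\<xi> using \<open>k > 0\<close> vP[of b] by (simp add: field_simps)
  also note le
  also have "(1 + 1 / k) * ((v a + k * P a) * exp (- m * (b - a)))
      \<le> (1 + 1 / k) * (((1 + k) * (norm (\<xi> a))\<^sup>2) * exp (- m * (b - a)))"
    unfolding norm_\<xi> using \<open>k > 0\<close> vP[of a]
    by (intro mult_left_mono mult_right_mono) (auto simp: field_simps)
  also have "\<dots> = (sqrt ((1 + 1 / k) * (1 + k)) * exp (- (m / 2) * (b - a)) * norm (\<xi> a))\<^sup>2"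
    using \<open>k > 0\<close> by (simp add: power_mult_distrib flip: exp_double)
  finally show ?thesis
    using \<open>k > 0\<close> by (auto intro: power2_le_imp_le[rotated])
qed

lemma height_bound_le:
  assumes \<xi>: "trajectory (E1 \<alpha> \<gamma> e) (Upsilon1 e) \<xi>" and "0 \<le> a" "a \<le> t"
  shows "height_bound (\<xi> a) \<le> (e - snd (\<xi> t)) \<bullet> e"
proof -
  have "height_bound (\<xi> a) \<le> (e - snd (\<xi> t)) \<bullet> e - 2 * \<gamma> / \<alpha> * (exp (- \<alpha> * t) * norm (fst (\<xi> 0)))"
    using height_bound_mono[OF trajectory_sphere_solution(1)[OF \<xi>] assms(2,3)]
      trajectory_sphere_solution(2)[OF \<xi>, of a] assms(2,3) by (simp add: height_bound_def)
  also have "\<dots> \<le> (e - snd (\<xi> t)) \<bullet> e"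
    using \<alpha>_pos \<gamma>_pos by simp
  finally show ?thesis .
qed

lemma trajectory_tendsto_0:
  assumes \<xi>: "trajectory (E1 \<alpha> \<gamma> e) (Upsilon1 e) \<xi>" and "0 \<le> a" and a: "height_bound (\<xi> a) > - 1"
  shows "(\<xi> \<longlongrightarrow> 0) at_top"
proof -
  \<comment> \<open>The gap above -1 at time \<open>a\<close> is kept at all later times, so it can
    serve as the constant \<open>c\<close> of the decay estimate.\<close>
  define c m k where "c = height_bound (\<xi> a) + 1" and "m = min (\<gamma> * c / 2) \<alpha>" and "k = 2 * \<gamma> / (c * \<alpha>)"
  have "c > 0" using a by (simp add: c_def)
  then have "m > 0" using \<alpha>_pos \<gamma>_pos by (simp add: m_def)
  have c: "c - 1 \<le> (e - snd (\<xi> t)) \<bullet> e" if "t \<ge> a" for t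
    using height_bound_le[OF \<xi> \<open>0 \<le> a\<close> that] by (simp add: c_def)
  have le: "norm (\<xi> t) \<le> sqrt ((1 + 1 / k) * (1 + k)) * exp (- (m / 2) * (t - a)) * norm (\<xi> a)" if "t \<ge> a" for t
    by (rule trajectory_decay[OF \<xi> \<open>0 \<le> a\<close> that \<open>c > 0\<close> c]) (auto simp: m_def k_def)
  define C where "C = sqrt ((1 + 1 / k) * (1 + k)) * exp (m / 2 * a) * norm (\<xi> a)"
  have "((\<lambda>t. C * exp (- (m / 2) * t)) \<longlongrightarrow> 0) at_top"
    using tendsto_mult_right_zero[OF exp_neg_tendsto_0[of "m / 2"]] \<open>m > 0\<close> by simp
  moreover have "norm (\<xi> t) \<le> C * exp (- (m / 2) * t)" if "t \<ge> a" for t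
  proof -
    have "exp (- (m / 2) * (t - a)) = exp (m / 2 * a) * exp (- (m / 2) * t)"
      unfolding exp_add[symmetric] by (simp add: field_simps)
    with le[OF that] show ?thesis by (simp add: C_def mult_ac)
  qed
  ultimately show ?thesis
    by (intro Lim_null_comparison[of \<xi> "\<lambda>t. C * exp (- (m / 2) * t)"] eventually_at_top_linorderI[of a])
qed

text \<open>Since z - 2 e = - (x + e), its squared norm is 2 + 2 (x \<bullet> e), which the
  hypothesis bounds by twice the reserve, and the reserve tends to 0 with p.\<close>

lemma trajectory_tendsto_2e:
  assumes \<xi>: "trajectory (E1 \<alpha> \<gamma> e) (Upsilon1 e) \<xi>"
    and le: "\<And>t. t \<ge> 0 \<Longrightarrow> height_bound (\<xi> t) \<le> - 1"
  shows "(\<xi> \<longlongrightarrow> (0, 2 *\<^sub>R e)) at_top"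
proof -
  define B where "B = norm (fst (\<xi> 0))"
  have fst_eq: "norm (fst (\<xi> t)) = exp (- \<alpha> * t) * B" if "t \<ge> 0" for t
    using trajectory_sphere_solution(2)[OF \<xi> that] by (simp add: B_def)
  have snd_le: "norm (snd (\<xi> t) - 2 *\<^sub>R e) \<le> sqrt (4 * \<gamma> / \<alpha> * (exp (- \<alpha> * t) * B))" if "t \<ge> 0" for t
  proof (rule real_le_rsqrt)
    have "norm (e - snd (\<xi> t)) = 1"
      using trajectory_sphere_solution(3)[OF \<xi> that] by (simp add: mem_Upsilon1_iff)
    then have "norm (- (e - snd (\<xi> t))) = 1" by (simp only: norm_minus_cancel)
    from norm_diff_e[OF this]
    have "(norm (snd (\<xi> t) - 2 *\<^sub>R e))\<^sup>2 = 2 + 2 * ((e - snd (\<xi> t)) \<bullet> e)"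
      by (subst norm_minus_commute) (simp add: scaleR_2 algebra_simps)
    also have "\<dots> \<le> 4 * \<gamma> / \<alpha> * (exp (- \<alpha> * t) * B)"
      using le[OF that] fst_eq[OF that] by (simp add: height_bound_def)
    finally show "(norm (snd (\<xi> t) - 2 *\<^sub>R e))\<^sup>2 \<le> 4 * \<gamma> / \<alpha> * (exp (- \<alpha> * t) * B)" .
  qed
  have "((\<lambda>t. exp (- \<alpha> * t) * B) \<longlongrightarrow> 0) at_top"
    using tendsto_mult_left_zero[OF exp_neg_tendsto_0[OF \<alpha>_pos]] .
  then have "((\<lambda>t. fst (\<xi> t)) \<longlongrightarrow> 0) at_top"
    by (rule Lim_null_comparison[rotated]) (use fst_eq in \<open>auto intro: eventually_at_top_linorderI[of 0]\<close>)
  moreover have "((\<lambda>t. sqrt (4 * \<gamma> / \<alpha> * (exp (- \<alpha> * t) * B))) \<longlongrightarrow> sqrt (4 * \<gamma> / \<alpha> * 0)) at_top"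
    by (intro tendsto_intros) fact
  then have "((\<lambda>t. sqrt (4 * \<gamma> / \<alpha> * (exp (- \<alpha> * t) * B))) \<longlongrightarrow> 0) at_top" by simp
  then have "((\<lambda>t. snd (\<xi> t) - 2 *\<^sub>R e) \<longlongrightarrow> 0) at_top"
    by (rule Lim_null_comparison[rotated]) (use snd_le in \<open>auto intro: eventually_at_top_linorderI[of 0]\<close>)
  then have "((\<lambda>t. snd (\<xi> t)) \<longlongrightarrow> 2 *\<^sub>R e) at_top"
    by (rule LIM_zero_cancel)
  ultimately show ?thesis
    using tendsto_Pair by fastforce
qed

text \<open>While both heights are within the reserve of -1, both x \<bullet> u and x' \<bullet> u
  are at most -1 + B exp (- \<alpha> t). So |x - x'|^2 grows like exp (2 \<gamma> t), up to a factor
  bounded away from 0. Two distinct solutions would eventually be farther apart than the diameter of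
  the sphere.\<close>

lemma exceptional_direction_unique:
  assumes x: "sphere_solution p {0..} x" and x': "sphere_solution p {0..} x'"
    and h: "\<And>t. t \<ge> 0 \<Longrightarrow> x t \<bullet> e - 2 * \<gamma> / \<alpha> * (exp (- \<alpha> * t) * norm p) \<le> - 1"
    and h': "\<And>t. t \<ge> 0 \<Longrightarrow> x' t \<bullet> e - 2 * \<gamma> / \<alpha> * (exp (- \<alpha> * t) * norm p) \<le> - 1"
  shows "x 0 = x' 0"
proof (rule ccontr)
  assume "x 0 \<noteq> x' 0"
  \<comment> \<open>The first summand is the reserve in the hypotheses on the height; the 1 accounts
    for the p component of the drive.\<close>
  define B where "B = (2 * \<gamma> / \<alpha> + 1) * norm p"
  define q where "q t = 2 - 2 * (x t \<bullet> x' t)" for t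
  \<comment> \<open>An antiderivative of the lower bound \<gamma> (2 - 2 B exp (- \<alpha> t)) for
    the logarithmic growth rate of \<open>q\<close>.\<close>
  define G where "G t = \<gamma> * (2 * t + 2 * B / \<alpha> * exp (- \<alpha> * t))" for t
  have q_norm: "q t = (norm (x t - x' t))\<^sup>2" if "t \<ge> 0" for t
    unfolding power2_norm_eq_inner
    using sphere_solution_inner_self[OF x, of t] sphere_solution_inner_self[OF x', of t] that
    by (simp add: q_def inner_diff_left inner_diff_right inner_commute)
  have drive_le: "y \<bullet> drive p t \<le> - 1 + B * exp (- \<alpha> * t)"
    if "norm y = 1" "y \<bullet> e - 2 * \<gamma> / \<alpha> * (exp (- \<alpha> * t) * norm p) \<le> - 1" for y t
  proof -
    have "- (y \<bullet> p) \<le> norm p"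
      using norm_cauchy_schwarz[of "- y" p] that(1) by simp
    then have "exp (- \<alpha> * t) * - (y \<bullet> p) \<le> exp (- \<alpha> * t) * norm p"
      by (intro mult_left_mono) auto
    then show ?thesis
      using that(2) by (simp add: drive_def inner_diff_right B_def algebra_simps)
  qed
  have growth: "q 0 * exp (G T - G 0) \<le> q T" if "T \<ge> 0" for T
  proof (rule integrating_factor[OF that,
        where q' = "\<lambda>t. - \<gamma> * (x t \<bullet> drive p t + x' t \<bullet> drive p t) * q t"
          and g = "\<lambda>t. \<gamma> * (2 - 2 * B * exp (- \<alpha> * t))"])
    fix t assume t: "t \<in> {0..T}"
    have sub: "sphere_solution p {0..T} x" "sphere_solution p {0..T} x'"
      using x x' by (auto intro: sphere_solution_subset)
    have "(q has_real_derivative 0 - 2 * (x t \<bullet> (\<gamma> *\<^sub>R (drive p t - (x' t \<bullet> drive p t) *\<^sub>R x' t))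
        + (\<gamma> *\<^sub>R (drive p t - (x t \<bullet> drive p t) *\<^sub>R x t)) \<bullet> x' t)) (at t within {0..T})"
      unfolding q_def[abs_def]
      by (intro DERIV_diff DERIV_const DERIV_cmult has_real_derivative_inner sphere_solution_derivative[OF _ t] sub)
    then show "(q has_real_derivative - \<gamma> * (x t \<bullet> drive p t + x' t \<bullet> drive p t) * q t) (at t within {0..T})"
      by (rule DERIV_cong)
        (simp add: q_def inner_diff_left inner_diff_right inner_commute algebra_simps)
    show "(G has_real_derivative \<gamma> * (2 - 2 * B * exp (- \<alpha> * t))) (at t within {0..T})"
      unfolding G_def[abs_def] using \<alpha>_pos by (auto intro!: derivative_eq_intros simp: field_simps)
    have "2 - 2 * B * exp (- \<alpha> * t) \<le> - (x t \<bullet> drive p t + x' t \<bullet> drive p t)"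
      using drive_le[OF sphere_solution_norm[OF x, of t] h[of t]] drive_le[OF sphere_solution_norm[OF x', of t] h'[of t]] t
      by simp
    then have "\<gamma> * (2 - 2 * B * exp (- \<alpha> * t)) * q t \<le> \<gamma> * - (x t \<bullet> drive p t + x' t \<bullet> drive p t) * q t"
      using q_norm[of t] t \<gamma>_pos by (intro mult_right_mono mult_left_mono) auto
    then show "\<gamma> * (2 - 2 * B * exp (- \<alpha> * t)) * q t \<le> - \<gamma> * (x t \<bullet> drive p t + x' t \<bullet> drive p t) * q t"
      by (simp only: mult_minus_left mult_minus_right)
  qed
  have "q T \<le> 4" if "T \<ge> 0" for T
    using norm_cauchy_schwarz[of "- x T" "x' T"] sphere_solution_norm[OF x, of T] sphere_solution_norm[OF x', of T] that
    by (simp add: q_def)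
  then have bounded: "q 0 * exp (G T - G 0) \<le> 4" if "T \<ge> 0" for T
    using growth[OF that] that order_trans by blast
  have "q 0 > 0"
    using q_norm[of 0] \<open>x 0 \<noteq> x' 0\<close> by simp
  \<comment> \<open>Chosen so that G T - G 0 \<ge> 4 / q 0. Then exp y \<ge> 1 + y pushes the lower
    bound for q T to at least q 0 + 4, beyond the maximal squared distance 4.\<close>
  define T where "T = (4 / q 0 + \<bar>G 0\<bar>) / (2 * \<gamma>)"
  have "T \<ge> 0" using \<open>q 0 > 0\<close> \<gamma>_pos by (simp add: T_def)
  have "0 \<le> B" using \<alpha>_pos \<gamma>_pos by (simp add: B_def)
  then have "2 * \<gamma> * T \<le> G T" using \<gamma>_pos \<alpha>_pos by (simp add: G_def distrib_left)
  moreover have "2 * \<gamma> * T = 4 / q 0 + \<bar>G 0\<bar>" using \<gamma>_pos by (simp add: T_def)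
  ultimately have "1 + 4 / q 0 \<le> 1 + (G T - G 0)" by linarith
  also have "\<dots> \<le> exp (G T - G 0)" by (rule exp_ge_add_one_self)
  finally have "q 0 * (1 + 4 / q 0) \<le> q 0 * exp (G T - G 0)"
    using \<open>q 0 > 0\<close> by (intro mult_left_mono) auto
  with bounded[OF \<open>T \<ge> 0\<close>] \<open>q 0 > 0\<close> show False
    by (simp add: distrib_left)
qed

section \<open>Stability and the basin of the origin\<close>

lemma zero_mem_equilibria: "0 \<in> equilibria (E1 \<alpha> \<gamma> e) (Upsilon1 e)"
  by (simp add: equilibria_def mem_Upsilon1_iff norm_e zero_prod_def E1_eq)

lemma equilibria_E1: "equilibria (E1 \<alpha> \<gamma> e) (Upsilon1 e) = {(0, 0), (0, 2 *\<^sub>R e)}"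
proof (intro equalityI subsetI)
  fix \<xi> assume "\<xi> \<in> equilibria (E1 \<alpha> \<gamma> e) (Upsilon1 e)"
  moreover obtain p z where \<xi>: "\<xi> = (p, z)" by (cases \<xi>)
  ultimately have n: "norm (e - z) = 1" and eq: "E1 \<alpha> \<gamma> e (p, z) = (0, 0)"
    by (auto simp: equilibria_def mem_Upsilon1_iff zero_prod_def)
  from eq have p: "p = 0" using \<alpha>_pos by (simp add: E1_eq)
  with eq n have e: "e = ((e - z) \<bullet> e) *\<^sub>R (e - z)"
    using \<gamma>_pos by (simp add: E1_eq norm_eq_1)
  then have "norm e = \<bar>(e - z) \<bullet> e\<bar> * norm (e - z)" by (metis norm_scaleR)
  then have "(e - z) \<bullet> e = 1 \<or> (e - z) \<bullet> e = - 1" using n norm_e by auto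
  then show "\<xi> \<in> {(0, 0), (0, 2 *\<^sub>R e)}"
  proof
    assume "(e - z) \<bullet> e = 1"
    with e have "e = e - z" by simp
    then show ?thesis by (simp add: \<xi> p)
  next
    assume "(e - z) \<bullet> e = - 1"
    with e have "e = - (e - z)" by simp
    then have "z = 2 *\<^sub>R e" by (simp add: scaleR_2 algebra_simps)
    then show ?thesis by (simp add: \<xi> p)
  qed
next
  fix \<xi> assume "\<xi> \<in> {(0 :: real^3, 0), (0, 2 *\<^sub>R e)}"
  then consider "\<xi> = 0" | "\<xi> = (0, 2 *\<^sub>R e)"
    by (auto simp: zero_prod_def)
  then show "\<xi> \<in> equilibria (E1 \<alpha> \<gamma> e) (Upsilon1 e)"
  proof cases
    case 1
    then show ?thesis using zero_mem_equilibria by simp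
  next
    case 2
    have "(0, z) \<in> equilibria (E1 \<alpha> \<gamma> e) (Upsilon1 e)" if "e - z = - e" for z
      by (simp add: equilibria_def mem_Upsilon1_iff norm_e E1_eq e_inner_e zero_prod_def that)
    then show ?thesis unfolding 2 by (simp add: scaleR_2)
  qed
qed

lemma origin_locally_exponentially_stable:
  "locally_exponentially_stable (E1 \<alpha> \<gamma> e) (Upsilon1 e) 0"
proof -
  \<comment> \<open>For a state of norm at most 1 the height is 1 - |z|^2 / 2 \<ge> 1 - |\<xi>| / 2
    and the reserve is at most (2 \<gamma> / \<alpha>) |\<xi>|, so the height bound is at least 1 -
    B |\<xi>|. The radius \<delta> makes this nonnegative, and the decay estimate applies with c =
    1, the literal 1 in \<open>m\<close> and \<open>k\<close>.\<close>
  define B where "B = 1 / 2 + 2 * \<gamma> / \<alpha>"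
  have "B > 0" using \<alpha>_pos \<gamma>_pos by (simp add: B_def add_pos_pos)
  define \<delta> m k where "\<delta> = min 1 (1 / B)" and "m = min (\<gamma> * 1 / 2) \<alpha>" and "k = 2 * \<gamma> / (1 * \<alpha>)"
  define C where "C = sqrt ((1 + 1 / k) * (1 + k))"
  have "\<delta> > 0" "m / 2 > 0" "k > 0" using \<open>B > 0\<close> \<alpha>_pos \<gamma>_pos by (auto simp: \<delta>_def m_def k_def)
  have "C > 0" using \<open>k > 0\<close> by (simp add: C_def add_pos_pos)
  have "norm (\<xi> t) \<le> C * exp (- (m / 2) * t) * norm (\<xi> 0)"
    if \<xi>: "trajectory (E1 \<alpha> \<gamma> e) (Upsilon1 e) \<xi>" and small: "norm (\<xi> 0) < \<delta>" and "t \<ge> 0" for \<xi> t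
  proof -
    have "norm (fst (\<xi> 0)) \<le> norm (\<xi> 0)" and z: "norm (snd (\<xi> 0)) \<le> norm (\<xi> 0)"
      using norm_fst_le[of "fst (\<xi> 0)" "snd (\<xi> 0)"] norm_snd_le[of "snd (\<xi> 0)" "fst (\<xi> 0)"] by auto
    then have p: "2 * \<gamma> / \<alpha> * norm (fst (\<xi> 0)) \<le> 2 * \<gamma> / \<alpha> * norm (\<xi> 0)"
      using \<alpha>_pos \<gamma>_pos by (intro mult_left_mono) auto
    have "norm (e - snd (\<xi> 0)) = 1"
      using trajectory_sphere_solution(3)[OF \<xi>, of 0] by (simp add: mem_Upsilon1_iff)
    from norm_diff_e[OF this] have "(norm (snd (\<xi> 0)))\<^sup>2 = 2 - 2 * ((e - snd (\<xi> 0)) \<bullet> e)" by simp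
    then have "(e - snd (\<xi> 0)) \<bullet> e = 1 - (norm (snd (\<xi> 0)))\<^sup>2 / 2" by linarith
    moreover have "(norm (snd (\<xi> 0)))\<^sup>2 \<le> norm (\<xi> 0)"
    proof -
      have "(norm (snd (\<xi> 0)))\<^sup>2 \<le> norm (\<xi> 0) * 1"
        unfolding power2_eq_square using z small by (intro mult_mono) (auto simp: \<delta>_def)
      then show ?thesis by simp
    qed
    moreover have "norm (\<xi> 0) * B \<le> 1"
      using small \<open>B > 0\<close> by (simp add: \<delta>_def pos_less_divide_eq)
    ultimately have "0 \<le> height_bound (\<xi> 0)"
      using p by (simp add: height_bound_def B_def algebra_simps)
    then have "1 - 1 \<le> (e - snd (\<xi> s)) \<bullet> e" if "s \<ge> 0" for s
      using height_bound_le[OF \<xi> order_refl that] by simp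
    from trajectory_decay[OF \<xi> order_refl \<open>t \<ge> 0\<close> zero_less_one this, of m k]
    show ?thesis by (simp add: m_def k_def C_def)
  qed
  then show ?thesis
    unfolding locally_exponentially_stable_def
    using zero_mem_equilibria \<open>\<delta> > 0\<close> \<open>m / 2 > 0\<close> \<open>C > 0\<close>
    by (intro conjI exI[of _ \<delta>] exI[of _ C] exI[of _ "m / 2"]) auto
qed

lemma origin_locally_stable: "locally_stable (E1 \<alpha> \<gamma> e) (Upsilon1 e) 0"
  unfolding locally_stable_def
proof (intro allI impI)
  fix \<epsilon> :: real assume "\<epsilon> > 0"
  obtain \<delta> C m where "\<delta> > 0" "C > 0" "m > 0"
    and decay: "\<And>\<xi> t. trajectory (E1 \<alpha> \<gamma> e) (Upsilon1 e) \<xi> \<Longrightarrow> dist (\<xi> 0) 0 < \<delta> \<Longrightarrow> t \<ge> 0 \<Longrightarrow>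
      dist (\<xi> t) 0 \<le> C * exp (- m * t) * dist (\<xi> 0) 0"
    using origin_locally_exponentially_stable unfolding locally_exponentially_stable_def by metis
  have "dist (\<xi> t) 0 < \<epsilon>"
    if \<xi>: "trajectory (E1 \<alpha> \<gamma> e) (Upsilon1 e) \<xi>" "dist (\<xi> 0) 0 < min \<delta> (\<epsilon> / C)" and "t \<ge> 0" for \<xi> t
  proof -
    have "dist (\<xi> t) 0 \<le> C * exp (- m * t) * dist (\<xi> 0) 0"
      using \<xi> \<open>t \<ge> 0\<close> by (intro decay) auto
    also have "\<dots> \<le> C * 1 * dist (\<xi> 0) 0"
      using \<open>C > 0\<close> \<open>m > 0\<close> \<open>t \<ge> 0\<close> by (intro mult_right_mono mult_left_mono) auto
    also have "\<dots> < \<epsilon>"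
      using \<xi>(2) \<open>C > 0\<close> by (simp add: pos_less_divide_eq mult.commute)
    finally show ?thesis .
  qed
  then show "\<exists>\<delta>>0. \<forall>\<xi>. trajectory (E1 \<alpha> \<gamma> e) (Upsilon1 e) \<xi> \<and> dist (\<xi> 0) 0 < \<delta> \<longrightarrow>
      (\<forall>t\<ge>0. dist (\<xi> t) 0 < \<epsilon>)"
    using \<open>\<delta> > 0\<close> \<open>C > 0\<close> \<open>\<epsilon> > 0\<close> by (intro exI[of _ "min \<delta> (\<epsilon> / C)"]) auto
qed

section \<open>Continuous dependence of trajectories and the basin of the origin\<close>

lemma trajectory_dist_le:
  assumes \<xi>: "trajectory (E1 \<alpha> \<gamma> e) (Upsilon1 e) \<xi>" and \<xi>': "trajectory (E1 \<alpha> \<gamma> e) (Upsilon1 e) \<xi>'"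
    and "T \<ge> 0"
  shows "dist (\<xi> T) (\<xi>' T) \<le>
    dist (\<xi> 0) (\<xi>' 0) * exp ((\<gamma> + 2 * \<gamma> * (1 + norm (fst (\<xi> 0))) + \<alpha>) * T)"
proof (rule power2_le_imp_le)
  \<comment> \<open>The exponent involves the first trajectory only. A neighbourhood of its initial
    state can therefore be chosen uniformly over the second one.\<close>
  let ?L = "\<gamma> + 2 * \<gamma> * (1 + norm (fst (\<xi> 0))) + \<alpha>"
  have seg: "closed_segment 0 T \<subseteq> {0..}"
    using \<open>T \<ge> 0\<close> by (auto simp: closed_segment_eq_real_ivl)
  have M: "norm (drive (fst (\<xi> 0)) t) \<le> 1 + norm (fst (\<xi> 0))" if "t \<in> closed_segment 0 T" for t
  proof -
    have "exp (- \<alpha> * t) \<le> 1" using that seg \<alpha>_pos by auto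
    then have "exp (- \<alpha> * t) * norm (fst (\<xi> 0)) \<le> 1 * norm (fst (\<xi> 0))" by (intro mult_right_mono) auto
    then show ?thesis using norm_drive_le[of "fst (\<xi> 0)" t] by simp
  qed
  have dist2: "(dist (\<xi> t) (\<xi>' t))\<^sup>2 = (norm ((e - snd (\<xi> t)) - (e - snd (\<xi>' t))))\<^sup>2
      + (norm (exp (- \<alpha> * t) *\<^sub>R (fst (\<xi> 0) - fst (\<xi>' 0))))\<^sup>2" if "t \<ge> 0" for t
    using trajectory_sphere_solution(2)[OF \<xi> that] trajectory_sphere_solution(2)[OF \<xi>' that]
    by (simp add: dist_norm norm_prod_def scaleR_diff_right norm_minus_commute)
  have "(dist (\<xi> T) (\<xi>' T))\<^sup>2 \<le> (dist (\<xi> 0) (\<xi>' 0))\<^sup>2 * exp (2 * (?L * T))"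
    unfolding dist2[OF \<open>T \<ge> 0\<close>] dist2[OF order_refl]
    using sphere_solution_dependence[OF sphere_solution_subset[OF trajectory_sphere_solution(1)[OF \<xi>] seg]
        sphere_solution_subset[OF trajectory_sphere_solution(1)[OF \<xi>'] seg] M] \<open>T \<ge> 0\<close>
    by (simp add: algebra_simps)
  also have "\<dots> = (dist (\<xi> 0) (\<xi>' 0) * exp (?L * T))\<^sup>2"
    by (simp only: power_mult_distrib exp_double)
  finally show "(dist (\<xi> T) (\<xi>' T))\<^sup>2 \<le> (dist (\<xi> 0) (\<xi>' 0) * exp (?L * T))\<^sup>2" .
qed simp

lemma trajectory_unique:
  assumes "trajectory (E1 \<alpha> \<gamma> e) (Upsilon1 e) \<xi>" "trajectory (E1 \<alpha> \<gamma> e) (Upsilon1 e) \<xi>'"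
    and "\<xi> 0 = \<xi>' 0" "t \<ge> 0"
  shows "\<xi> t = \<xi>' t"
  using trajectory_dist_le[OF assms(1,2,4)] assms(3) by simp

text \<open>Membership is witnessed at one finite time, so continuous dependence up to that time
  makes it an open condition; convergence to the origin is not visibly open. By
  \<open>trajectory_unique\<close> any trajectory from the given state can be the witness.\<close>

definition basin :: "((real^3) \<times> (real^3)) set" where
  "basin = {\<xi>\<^sub>0. \<exists>\<xi> T. trajectory (E1 \<alpha> \<gamma> e) (Upsilon1 e) \<xi> \<and> \<xi> 0 = \<xi>\<^sub>0 \<and> T \<ge> 0 \<and> height_bound (\<xi> T) > - 1}"

lemma basin_tendsto:
  assumes "trajectory (E1 \<alpha> \<gamma> e) (Upsilon1 e) \<xi>" "\<xi> 0 \<in> basin"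
  shows "(\<xi> \<longlongrightarrow> 0) at_top"
proof -
  obtain \<xi>' T where \<xi>': "trajectory (E1 \<alpha> \<gamma> e) (Upsilon1 e) \<xi>'" "\<xi>' 0 = \<xi> 0"
    and T: "T \<ge> 0" "height_bound (\<xi>' T) > - 1"
    using assms(2) unfolding basin_def by auto
  have "\<xi>' T = \<xi> T" using trajectory_unique[OF \<xi>'(1) assms(1) \<xi>'(2) T(1)] .
  then show ?thesis using trajectory_tendsto_0[OF assms(1) T(1)] T(2) by simp
qed

lemma openin_basin: "openin (top_of_set (Upsilon1 e)) basin"
  unfolding openin_euclidean_subtopology_iff
proof (intro conjI ballI)
  show "basin \<subseteq> Upsilon1 e"
    using trajectory_sphere_solution(3) by (force simp: basin_def)
  fix \<xi>\<^sub>0 assume "\<xi>\<^sub>0 \<in> basin"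
  then obtain \<xi> T where \<xi>: "trajectory (E1 \<alpha> \<gamma> e) (Upsilon1 e) \<xi>" and \<xi>0: "\<xi> 0 = \<xi>\<^sub>0"
    and T: "T \<ge> 0" "height_bound (\<xi> T) > - 1"
    unfolding basin_def by auto
  define E where "E = exp ((\<gamma> + 2 * \<gamma> * (1 + norm (fst \<xi>\<^sub>0)) + \<alpha>) * T)"
  have "E > 0" by (simp add: E_def)
  have "continuous_on UNIV height_bound"
    unfolding height_bound_def[abs_def] by (intro continuous_intros)
  then have "open {\<xi>. - 1 < height_bound \<xi>}"
    by (intro open_Collect_less continuous_intros) auto
  then obtain \<epsilon> where "\<epsilon> > 0" and \<epsilon>: "\<And>\<eta>. dist \<eta> (\<xi> T) < \<epsilon> \<Longrightarrow> - 1 < height_bound \<eta>"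
    using T(2) unfolding open_dist by blast
  show "\<exists>d>0. \<forall>\<xi>'\<in>Upsilon1 e. dist \<xi>' \<xi>\<^sub>0 < d \<longrightarrow> \<xi>' \<in> basin"
  proof (intro exI[of _ "\<epsilon> / E"] conjI ballI impI)
    show "\<epsilon> / E > 0" using \<open>\<epsilon> > 0\<close> \<open>E > 0\<close> by simp
    fix \<eta>\<^sub>0 assume "\<eta>\<^sub>0 \<in> Upsilon1 e" and near: "dist \<eta>\<^sub>0 \<xi>\<^sub>0 < \<epsilon> / E"
    then obtain \<eta> where \<eta>: "trajectory (E1 \<alpha> \<gamma> e) (Upsilon1 e) \<eta>" "\<eta> 0 = \<eta>\<^sub>0"
      using trajectory_exists by blast
    have "dist (\<xi> T) (\<eta> T) \<le> dist \<xi>\<^sub>0 \<eta>\<^sub>0 * E"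
      using trajectory_dist_le[OF \<xi> \<eta>(1) T(1)] by (simp add: \<xi>0 \<eta>(2) E_def)
    also have "\<dots> < \<epsilon>"
      using near \<open>E > 0\<close> by (simp add: pos_less_divide_eq dist_commute)
    finally have "- 1 < height_bound (\<eta> T)"
      using \<epsilon> by (simp add: dist_commute)
    then show "\<eta>\<^sub>0 \<in> basin"
      using \<eta> T(1) by (auto simp: basin_def)
  qed
qed

text \<open>Only the second component is perturbed: the uniqueness of the exceptional direction
  compares solutions with the same p. In the fibre over p at most one point is outside the basin,
  and the sphere has no isolated points.\<close>

lemma basin_dense: "Upsilon1 e \<subseteq> closure basin"
proof
  fix \<xi>\<^sub>0 assume \<xi>\<^sub>0: "\<xi>\<^sub>0 \<in> Upsilon1 e"
  show "\<xi>\<^sub>0 \<in> closure basin"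
  proof (cases "\<xi>\<^sub>0 \<in> basin")
    case True
    then show ?thesis using closure_subset by blast
  next
    case False
    obtain p z where pz: "\<xi>\<^sub>0 = (p, z)" by (cases \<xi>\<^sub>0)
    have mem: "e - z \<in> sphere 0 1" using \<xi>\<^sub>0 by (simp add: mem_Upsilon1_iff pz)
    \<comment> \<open>A connected set with more than one point is perfect; the points e and -e show
      that the sphere is not a singleton.\<close>
    have "2 \<le> DIM(real^3)" by simp
    then have "connected (sphere (0 :: real^3) 1)" by (rule connected_sphere)
    moreover have "sphere (0 :: real^3) 1 \<noteq> {y}" for y
    proof
      assume "sphere (0 :: real^3) 1 = {y}"
      moreover have "e \<in> sphere 0 1" "- e \<in> sphere 0 1" using norm_e by auto
      ultimately have "e = y" "- e = y" by blast+
      then have "e \<bullet> e = (- e) \<bullet> e" by metis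
      then show False using e_inner_e by simp
    qed
    ultimately have lim: "(e - z) islimpt sphere 0 1"
      using mem by (intro connected_imp_perfect) auto
    show ?thesis
      unfolding closure_approachable
    proof (intro allI impI)
      fix \<epsilon> :: real assume "\<epsilon> > 0"
      then obtain y where y: "norm y = 1" "y \<noteq> e - z" "dist y (e - z) < \<epsilon>"
        using lim unfolding islimpt_approachable by auto
      have "(p, e - y) \<in> basin"
      proof (rule ccontr)
        assume notin: "(p, e - y) \<notin> basin"
        have exceptional: "x t \<bullet> e - 2 * \<gamma> / \<alpha> * (exp (- \<alpha> * t) * norm p) \<le> - 1"
          if x: "sphere_solution p {0..} x" and "(p, e - x 0) \<notin> basin" and "t \<ge> 0" for x t
        proof -
          define \<xi> where "\<xi> t = (exp (- \<alpha> * t) *\<^sub>R p, e - x t)" for t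
          have "trajectory (E1 \<alpha> \<gamma> e) (Upsilon1 e) \<xi>"
            unfolding trajectory_def \<xi>_def[abs_def] by (rule sphere_solution_imp_solution_on[OF x])
          moreover have "\<xi> 0 \<notin> basin" using that(2) by (simp add: \<xi>_def)
          ultimately have "\<not> height_bound (\<xi> t) > - 1"
            using \<open>t \<ge> 0\<close> unfolding basin_def by blast
          then show ?thesis by (simp add: height_bound_def \<xi>_def)
        qed
        have "norm (e - z) = 1" using mem by simp
        then obtain x where x: "sphere_solution p UNIV x" "x 0 = e - z"
          by (rule sphere_solution_exists)
        obtain x' where x': "sphere_solution p UNIV x'" "x' 0 = y"
          using sphere_solution_exists[OF y(1)] .
        have x0: "sphere_solution p {0..} x" and x0': "sphere_solution p {0..} x'"
          using x x' by (auto intro: sphere_solution_subset)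
        have nb: "(p, e - x 0) \<notin> basin" "(p, e - x' 0) \<notin> basin"
          using False notin by (simp_all add: x(2) x'(2) pz)
        have "x 0 = x' 0"
          using exceptional_direction_unique[OF x0 x0' exceptional[OF x0 nb(1)] exceptional[OF x0' nb(2)]] .
        then show False using x x' y by simp
      qed
      moreover have "dist (p, e - y) \<xi>\<^sub>0 < \<epsilon>"
      proof -
        have "e - y - z = - (y - (e - z))" by simp
        then have "norm (e - y - z) = norm (y - (e - z))" by (simp only: norm_minus_cancel)
        then show ?thesis using y(3) by (simp add: pz dist_Pair_Pair dist_norm)
      qed
      ultimately show "\<exists>y\<in>basin. dist y \<xi>\<^sub>0 < \<epsilon>" by blast
    qed
  qed
qed

lemma origin_almost_globally_asymptotically_stable:
  "almost_globally_asymptotically_stable (E1 \<alpha> \<gamma> e) (Upsilon1 e) 0"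
  unfolding almost_globally_asymptotically_stable_def
  using zero_mem_equilibria origin_locally_stable openin_basin basin_dense basin_tendsto by blast

lemma trajectory_converges:
  assumes "trajectory (E1 \<alpha> \<gamma> e) (Upsilon1 e) \<xi>"
  shows "(\<xi> \<longlongrightarrow> 0) at_top \<or> (\<xi> \<longlongrightarrow> (0, 2 *\<^sub>R e)) at_top"
  using trajectory_tendsto_0[OF assms] trajectory_tendsto_2e[OF assms] by (meson not_le)

text \<open>The rate conditions carry 2 \<rho> because the Lyapunov function controls the square of
  the norm.\<close>

lemma converges_exponentially_of_height_bound:
  assumes \<xi>: "trajectory (E1 \<alpha> \<gamma> e) (Upsilon1 e) \<xi>" and "c > 0" "c - 1 \<le> height_bound (\<xi> 0)"
    and "2 * \<rho> \<le> \<gamma> * c / 2" "2 * \<rho> \<le> \<alpha>"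
  shows "converges_exponentially \<xi> \<rho>"
proof -
  define k where "k = 2 * \<gamma> / (c * \<alpha>)"
  have "k > 0" using \<alpha>_pos \<gamma>_pos \<open>c > 0\<close> by (simp add: k_def)
  define C where "C = sqrt ((1 + 1 / k) * (1 + k)) * norm (\<xi> 0)"
  have "C \<ge> 0" using \<open>k > 0\<close> by (simp add: C_def)
  have c: "c - 1 \<le> (e - snd (\<xi> t)) \<bullet> e" if "t \<ge> 0" for t
    using height_bound_le[OF \<xi> order_refl that] assms(3) by simp
  \<comment> \<open>Exponential convergence asks for a positive constant, whereas \<open>C\<close>
    is 0 for the trajectory at the origin.\<close>
  have "norm (\<xi> t) \<le> (C + 1) * exp (- \<rho> * t)" if "t \<ge> 0" for t
  proof -
    have "norm (\<xi> t) \<le> C * exp (- \<rho> * t)"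
      using trajectory_decay[OF \<xi> order_refl that \<open>c > 0\<close> c assms(4,5) k_def] by (simp add: C_def mult_ac)
    also have "\<dots> \<le> (C + 1) * exp (- \<rho> * t)" by (intro mult_right_mono) auto
    finally show ?thesis .
  qed
  then show ?thesis
    unfolding converges_exponentially_def using \<open>C \<ge> 0\<close> by (intro exI[of _ "C + 1"]) auto
qed

end

text \<open>On a compact \<open>K\<close> the height \<open>(e - z) \<bullet> e\<close> stays above \<open>2 c - 1\<close> for some \<open>c > 0\<close>.  The gain
  \<open>\<gamma>\<close> is chosen from \<open>c\<close> and the rate, then \<open>\<alpha>\<close> large enough that the transient of \<open>p\<close> costs at
  most \<open>c\<close> in height.\<close>

lemma exponential_rate_on_compact:
  assumes norm_e: "norm e = 1" and K: "compact K" "K \<subseteq> Upsilon1_star e" and "\<rho> > 0"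
  obtains a g where "a > 0" "g > 0"
    "\<And>\<xi>. trajectory (E1 a g e) (Upsilon1 e) \<xi> \<Longrightarrow> \<xi> 0 \<in> K \<Longrightarrow> converges_exponentially \<xi> \<rho>"
proof -
  have pos: "(e - snd \<xi>) \<bullet> e > - 1" if "\<xi> \<in> K" for \<xi>
  proof -
    obtain p z where \<xi>: "\<xi> = (p, z)" by (cases \<xi>)
    have n: "norm (e - z) = 1" and ne: "z \<noteq> 2 *\<^sub>R e"
      using that K(2) by (auto simp: \<xi> Upsilon1_star_def sphere_at_def)
    \<comment> \<open>Expanding |x + e|^2 = 2 + 2 (x \<bullet> e) turns x \<noteq> - e into a strict
      lower bound for the height.\<close>
    have "(e - z) + e \<noteq> 0" using ne by (simp add: scaleR_2 algebra_simps)
    then have "0 < ((e - z) + e) \<bullet> ((e - z) + e)" by simp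
    also have "\<dots> = (e - z) \<bullet> (e - z) + 2 * ((e - z) \<bullet> e) + e \<bullet> e"
      by (simp only: inner_add_left inner_add_right inner_commute[of e "e - z"])
    also have "\<dots> = 2 + 2 * ((e - z) \<bullet> e)" using n norm_e by (simp only: norm_eq_1)
    finally show ?thesis by (simp add: \<xi>)
  qed
  obtain c where "c > 0" and c: "\<And>\<xi>. \<xi> \<in> K \<Longrightarrow> 2 * c - 1 \<le> (e - snd \<xi>) \<bullet> e"
  proof (cases "K = {}")
    case True
    then show thesis using that[of 1] by simp
  next
    case False
    have "continuous_on K (\<lambda>\<xi>. (e - snd \<xi>) \<bullet> e)" by (intro continuous_intros)
    from continuous_attains_inf[OF K(1) False this]
    obtain \<eta> where "\<eta> \<in> K" "\<And>\<xi>. \<xi> \<in> K \<Longrightarrow> (e - snd \<eta>) \<bullet> e \<le> (e - snd \<xi>) \<bullet> e" by blast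
    then show thesis
      \<comment> \<open>Half of the minimal gap above -1: one \<open>c\<close> is spent on the
        transient of p, the other remains for the decay estimate.\<close>
      using pos[of \<eta>] by (intro that[of "((e - snd \<eta>) \<bullet> e + 1) / 2"]) (auto simp: field_simps)
  qed
  obtain R where "R > 0" and R: "\<And>\<xi>. \<xi> \<in> K \<Longrightarrow> norm \<xi> \<le> R"
    using compact_imp_bounded[OF K(1)] by (auto simp: bounded_pos)
  \<comment> \<open>\<open>g\<close> makes g c / 2 equal to 2 \<rho>. The two entries of the maximum
    give a \<ge> 2 \<rho> and a reserve 2 g R / a of at most \<open>c\<close>.\<close>
  define g a where "g = 4 * \<rho> / c" and "a = max (2 * \<rho>) (2 * g * R / c)"
  have "g > 0" "a > 0" using \<open>\<rho> > 0\<close> \<open>c > 0\<close> by (auto simp: g_def a_def)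
  then interpret tilt_observer a g e by unfold_locales (use norm_e in auto)
  have "converges_exponentially \<xi> \<rho>"
    if \<xi>: "trajectory (E1 a g e) (Upsilon1 e) \<xi>" and "\<xi> 0 \<in> K" for \<xi>
  proof (rule converges_exponentially_of_height_bound[OF \<xi> \<open>c > 0\<close>])
    have "2 * g * R / c \<le> a" by (simp add: a_def)
    then have "2 * g / a * R \<le> c"
      using \<open>a > 0\<close> \<open>c > 0\<close> by (simp add: field_simps)
    moreover have "2 * g / a * norm (fst (\<xi> 0)) \<le> 2 * g / a * R"
      using norm_fst_le[of "fst (\<xi> 0)" "snd (\<xi> 0)"] R[OF \<open>\<xi> 0 \<in> K\<close>] \<open>a > 0\<close> \<open>g > 0\<close>
      by (intro mult_left_mono) auto
    ultimately show "c - 1 \<le> height_bound (\<xi> 0)"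
      using c[OF \<open>\<xi> 0 \<in> K\<close>] by (simp add: height_bound_def)
    show "2 * \<rho> \<le> g * c / 2" using \<open>c > 0\<close> by (simp add: g_def)
    show "2 * \<rho> \<le> a" by (simp add: a_def)
  qed
  with that \<open>a > 0\<close> \<open>g > 0\<close> show thesis by blast
qed

theorem theorem1:
  fixes \<alpha>\<^sub>1 \<gamma> :: real and e\<^sub>z :: "real^3"
  assumes "\<alpha>\<^sub>1 > 0" and "\<gamma> > 0" and "norm e\<^sub>z = 1"
  shows "dynamical_system_on (E1 \<alpha>\<^sub>1 \<gamma> e\<^sub>z) (Upsilon1 e\<^sub>z)
    \<and> equilibria (E1 \<alpha>\<^sub>1 \<gamma> e\<^sub>z) (Upsilon1 e\<^sub>z) = {(0, 0), (0, 2 *\<^sub>R e\<^sub>z)}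
    \<and> ((0, 0) :: (real^3) \<times> (real^3)) \<noteq> (0, 2 *\<^sub>R e\<^sub>z)
    \<and> (\<forall>\<xi>. trajectory (E1 \<alpha>\<^sub>1 \<gamma> e\<^sub>z) (Upsilon1 e\<^sub>z) \<xi> \<longrightarrow>
         (\<xi> \<longlongrightarrow> (0, 0)) at_top \<or> (\<xi> \<longlongrightarrow> (0, 2 *\<^sub>R e\<^sub>z)) at_top)
    \<and> almost_globally_asymptotically_stable (E1 \<alpha>\<^sub>1 \<gamma> e\<^sub>z) (Upsilon1 e\<^sub>z) (0, 0)
    \<and> locally_exponentially_stable (E1 \<alpha>\<^sub>1 \<gamma> e\<^sub>z) (Upsilon1 e\<^sub>z) (0, 0)
    \<and> (\<forall>K \<rho>. compact K \<and> K \<subseteq> Upsilon1_star e\<^sub>z \<and> \<rho> > 0 \<longrightarrow>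
         (\<exists>a g. a > 0 \<and> g > 0 \<and>
            (\<forall>\<xi>. trajectory (E1 a g e\<^sub>z) (Upsilon1 e\<^sub>z) \<xi> \<and> \<xi> 0 \<in> K \<longrightarrow>
               converges_exponentially \<xi> \<rho>)))"
proof -
  interpret tilt_observer \<alpha>\<^sub>1 \<gamma> e\<^sub>z by unfold_locales (fact assms)+
  have zero: "(0, 0) = (0 :: (real^3) \<times> (real^3))" by (simp add: zero_prod_def)
  show ?thesis
  proof (intro conjI)
    show "\<forall>\<xi>. trajectory (E1 \<alpha>\<^sub>1 \<gamma> e\<^sub>z) (Upsilon1 e\<^sub>z) \<xi> \<longrightarrow>
         (\<xi> \<longlongrightarrow> (0, 0)) at_top \<or> (\<xi> \<longlongrightarrow> (0, 2 *\<^sub>R e\<^sub>z)) at_top"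
      unfolding zero using trajectory_converges by blast
    show "\<forall>K \<rho>. compact K \<and> K \<subseteq> Upsilon1_star e\<^sub>z \<and> \<rho> > 0 \<longrightarrow>
         (\<exists>a g. a > 0 \<and> g > 0 \<and>
            (\<forall>\<xi>. trajectory (E1 a g e\<^sub>z) (Upsilon1 e\<^sub>z) \<xi> \<and> \<xi> 0 \<in> K \<longrightarrow>
               converges_exponentially \<xi> \<rho>))"
    proof (intro allI impI, elim conjE)
      fix K and \<rho> :: real assume "compact K" "K \<subseteq> Upsilon1_star e\<^sub>z" "\<rho> > 0"
      then obtain a g where "a > 0" "g > 0"
        "\<And>\<xi>. trajectory (E1 a g e\<^sub>z) (Upsilon1 e\<^sub>z) \<xi> \<Longrightarrow> \<xi> 0 \<in> K \<Longrightarrow> converges_exponentially \<xi> \<rho>"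
        using exponential_rate_on_compact[OF assms(3)] by metis
      then show "\<exists>a g. a > 0 \<and> g > 0 \<and>
          (\<forall>\<xi>. trajectory (E1 a g e\<^sub>z) (Upsilon1 e\<^sub>z) \<xi> \<and> \<xi> 0 \<in> K \<longrightarrow> converges_exponentially \<xi> \<rho>)"
        by blast
    qed
    show "((0, 0) :: (real^3) \<times> (real^3)) \<noteq> (0, 2 *\<^sub>R e\<^sub>z)"
      using assms(3) by auto
    show "almost_globally_asymptotically_stable (E1 \<alpha>\<^sub>1 \<gamma> e\<^sub>z) (Upsilon1 e\<^sub>z) (0, 0)"
      unfolding zero by (rule origin_almost_globally_asymptotically_stable)
    show "locally_exponentially_stable (E1 \<alpha>\<^sub>1 \<gamma> e\<^sub>z) (Upsilon1 e\<^sub>z) (0, 0)"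
      unfolding zero by (rule origin_locally_exponentially_stable)
  qed (rule dynamical_system_on_E1 equilibria_E1)+
qed

end
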